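(* Let $K$ be a cubic field with fundamental discriminant $d_K$ in which $3$ does not ramify, and let $F_K=(a,b,c,d)$ be an associated binary cubic form. Let $\mathcal{K}_F$ be the cube $(A,B)$ with $A=\begin{pmatrix}3a&b\\ b&c\end{pmatrix}$, $B=\begin{pmatrix}b&c\\ c&3d\end{pmatrix}$, and let $\mathcal{C}_{d_K}$ be the cube $(A',B')$ with $A'=\begin{pmatrix}0&3\\1&0\end{pmatrix}$ and $B'=\begin{pmatrix}\frac{d_K+3}{4}&3\\0&-1\end{pmatrix}$ if $d_K\equiv 1\pmod 4$, $B'=\begin{pmatrix}\frac{d_K}{4}&3\\0&-1\end{pmatrix}$ if $d_K\equiv 0\pmod 4$. Let $T_{F_K}=[\mathcal{K}_F]+[\mathcal{C}_{d_K}]\in \mathrm{Cl}(\mathbb{Z}^2\otimes\mathbb{Z}^2\otimes\mathbb{Z}^2;-3d_K)$. Then $$\big((\pi_1\circ\phi)(T_{F_K})\big)^{\pm1}=\tfrac12 q_K$$ as elements of $\mathrm{Cl}^+_{\mathbb{Q}(\sqrt{-3d_K})}$, where $\frac12 q_K$ is the form $x\mapsto\frac12\mathrm{tr}_{K/\mathbb{Q}}(x^2)$ on $O_K^0$ in the $\mathbb{Z}$-basis $\{\alpha_0,3\beta_0\}$ if $b\equiv 0$, $\{3\alpha_0,\beta_0\}$ if $c\equiv 0$, $\{\alpha_0-\beta_0,3\beta_0\}$ if $b\equiv -c$, $\{\alpha_0+\beta_0,3\beta_0\}$ if $b\equiv c \pmod 3$.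
   Context: A fundamental discriminant is the discriminant of a quadratic field. $(a,b,c,d)$ denotes $ax^3+bx^2y+cxy^2+dy^3$. By Delone–Faddeev, $K$ has an associated integral binary cubic form $F_K=(a,b,c,d)$ (unique up to $\mathrm{GL}_2(\mathbb{Z})$) of discriminant $d_K$ such that for a root $\theta$ of $F_K(x,1)$, $K=\mathbb{Q}(\theta)$ and $\{1,-a\theta,d/\theta\}$ is a $\mathbb{Z}$-basis of $O_K$; put $\alpha=-a\theta$, $\beta=d/\theta$, $\alpha_0=\alpha-\mathrm{tr}(\alpha)/3$, $\beta_0=\beta-\mathrm{tr}(\beta)/3$, and $O_K^0=\{x\in O_K:\mathrm{tr}_{K/\mathbb{Q}}(x)=0\}$. A $2\times2\times2$ integral cube is a pair $(A,B)$ of $2\times2$ integer matrices; set $Q_1(A,B)=-\det(Ax+By)$, $Q_2(A,B)=-\det\big(A\binom{x}{y}\,|\,B\binom{x}{y}\big)$, $Q_3(A,B)=-\det\big(A^t\binom{x}{y}\,|\,B^t\binom{x}{y}\big)$; these have a common discriminant, the discriminant of the cube. $\Gamma=\mathrm{SL}_2(\mathbb{Z})^3$ acts on cubes preserving the discriminant. $\mathrm{Cl}(\mathbb{Z}^2\otimes\mathbb{Z}^2\otimes\mathbb{Z}^2;\Delta)$ is Bhargava's group of $\Gamma$-classes of cubes of discriminant $\Delta$ with $Q_1,Q_2,Q_3$ primitive, whose group law is such that $\phi:[(A,B)]\mapsto([Q_1],[Q_2])$ is a group isomorphism onto $\mathrm{Cl}^+_{\mathbb{Q}(\sqrt\Delta)}\times\mathrm{Cl}^+_{\mathbb{Q}(\sqrt\Delta)}$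 (narrow class groups identified with $\mathrm{SL}_2(\mathbb{Z})$-classes of primitive binary quadratic forms under Gauss composition); $\pi_1$ is the first projection. The cubes $\mathcal{K}_F$ and $\mathcal{C}_{d_K}$ define elements of this group for $\Delta=-3d_K$.
   Formalization: For d_K ≡ 0 (mod 4) the upper right entry of B' is taken to be 0 instead of the printed 3; with 3 the form Q_1 of the cube C_{d_K} has discriminant 9 − 3d_K, so the cube would not define a class of discriminant −3d_K. *)

theory Defs
  imports
    "HOL-Analysis.Determinants"
    "HOL-Computational_Algebra.Polynomial"
    "HOL-Number_Theory.Cong"
    "HOL-Algebra.Ideal_Product"
begin

section \<open>Number fields as subfields of a field of characteristic 0\<close>

definition rat_scale :: "rat \<Rightarrow> 'a::field_char_0 \<Rightarrow> 'a" where
  "rat_scale q x = of_rat q * x"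

global_interpretation rat_vs: vector_space "rat_scale :: rat \<Rightarrow> 'a::field_char_0 \<Rightarrow> 'a"
  by unfold_locales (simp_all add: rat_scale_def of_rat_add of_rat_mult algebra_simps)

definition is_subfield :: "'a::field_char_0 set \<Rightarrow> bool" where
  "is_subfield K \<longleftrightarrow> 1 \<in> K \<and> (\<forall>x\<in>K. \<forall>y\<in>K. x - y \<in> K \<and> x / y \<in> K)"

text \<open>In \<open>rat_vs.dim\<close> infinite dimension is recorded as \<open>0\<close>, so for \<open>n > 0\<close> this says
  \<open>[K : \<rat>] = n\<close>.\<close>

definition number_field :: "nat \<Rightarrow> 'a::field_char_0 set \<Rightarrow> bool" where
  "number_field n K \<longleftrightarrow> is_subfield K \<and> n > 0 \<and> rat_vs.dim K = n"

definition rat_adjoin :: "'a::field_char_0 \<Rightarrow> 'a set" where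
  "rat_adjoin \<theta> = \<Inter>{L. is_subfield L \<and> \<theta> \<in> L}"

definition field_basis :: "'a::field_char_0 set \<Rightarrow> 'a set \<Rightarrow> bool" where
  "field_basis K B \<longleftrightarrow> rat_vs.independent B \<and> rat_vs.span B = K"

text \<open>The trace of the \<open>\<rat>\<close>-linear map \<open>y \<mapsto> x * y\<close> on \<open>K\<close>, computed as the sum of the diagonal
  entries of its matrix; it does not depend on the chosen basis.\<close>

definition field_trace :: "'a::field_char_0 set \<Rightarrow> 'a \<Rightarrow> rat" where
  "field_trace K x =
     (let B = (SOME B. field_basis K B) in \<Sum>b\<in>B. rat_vs.representation B (x * b) b)"

definition ring_of_ints :: "'a::field_char_0 set \<Rightarrow> 'a set" where
  "ring_of_ints K = {x \<in> K. algebraic_int x}"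

definition trace_zero_ints :: "'a::field_char_0 set \<Rightarrow> 'a set" where
  "trace_zero_ints K = {x \<in> ring_of_ints K. field_trace K x = 0}"

text \<open>\<open>w\<^sub>1, \<dots>, w\<^sub>n\<close> is a \<open>\<int>\<close>-basis of \<open>M\<close>: every element of \<open>M\<close> is a unique integral
  combination, and all such combinations lie in \<open>M\<close>.\<close>

definition int_basis :: "'a::field_char_0 ^ 'n \<Rightarrow> 'a set \<Rightarrow> bool" where
  "int_basis w M \<longleftrightarrow> bij_betw (\<lambda>c :: int ^ 'n. \<Sum>i\<in>UNIV. of_int (c $ i) * w $ i) UNIV M"

text \<open>\<open>D\<close> is the discriminant of \<open>K\<close>. The index type fixes the degree, since an integral basis has
  \<open>[K : \<rat>]\<close> elements.\<close>

definition has_discriminant :: "'n::finite itself \<Rightarrow> 'a::field_char_0 set \<Rightarrow> int \<Rightarrow> bool" where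
  "has_discriminant _ K D \<longleftrightarrow>
     (\<exists>w :: 'a ^ 'n. int_basis w (ring_of_ints K) \<and>
        of_int D = det (\<chi> i j. field_trace K (w $ i * w $ j)))"

definition fundamental_discriminant :: "int \<Rightarrow> bool" where
  "fundamental_discriminant D \<longleftrightarrow>
     (\<exists>L :: complex set. number_field 2 L \<and> has_discriminant TYPE(2) L D)"

definition int_ring :: "'a::field_char_0 set \<Rightarrow> 'a ring" where
  "int_ring K = \<lparr>carrier = ring_of_ints K, monoid.mult = (*), one = 1, zero = 0, add = (+)\<rparr>"

text \<open>\<open>p\<close> ramifies in \<open>K\<close> if the square of a prime ideal divides \<open>p O\<^sub>K\<close>; in a Dedekind domain,
  dividing means containing.\<close>

definition ramifies :: "nat \<Rightarrow> 'a::field_char_0 set \<Rightarrow> bool" where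
  "ramifies p K \<longleftrightarrow>
     (\<exists>P. primeideal P (int_ring K) \<and>
          cgenideal (int_ring K) (of_nat p) \<subseteq> ideal_prod (int_ring K) P P)"


section \<open>Binary cubic forms\<close>

text \<open>\<open>(a, b, c, d)\<close> stands for \<open>a x\<^sup>3 + b x\<^sup>2 y + c x y\<^sup>2 + d y\<^sup>3\<close>.\<close>

definition cubic_disc :: "int \<Rightarrow> int \<Rightarrow> int \<Rightarrow> int \<Rightarrow> int" where
  "cubic_disc a b c d = b^2 * c^2 - 4 * a * c^3 - 4 * b^3 * d - 27 * a^2 * d^2 + 18 * a * b * c * d"

text \<open>\<open>(a, b, c, d)\<close> is a form associated with the cubic field \<open>K\<close> of discriminant \<open>D\<close>, and \<open>\<theta>\<close> is
  the corresponding root.\<close>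

definition associated_form ::
    "'a::field_char_0 set \<Rightarrow> int \<Rightarrow> int \<Rightarrow> int \<Rightarrow> int \<Rightarrow> int \<Rightarrow> 'a \<Rightarrow> bool" where
  "associated_form K D a b c d \<theta> \<longleftrightarrow>
     cubic_disc a b c d = D \<and>
     of_int a * \<theta>^3 + of_int b * \<theta>^2 + of_int c * \<theta> + of_int d = 0 \<and>
     K = rat_adjoin \<theta> \<and>
     int_basis (vector [1, - of_int a * \<theta>, of_int d / \<theta>] :: 'a ^ 3) (ring_of_ints K)"

definition trace_free_part :: "'a::field_char_0 set \<Rightarrow> 'a \<Rightarrow> 'a" where
  "trace_free_part K x = x - of_rat (field_trace K x) / 3"


section \<open>Binary quadratic forms and the narrow class group\<close>

type_synonym bqf = "int ^ 2 \<Rightarrow> int"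

definition bqf_of :: "int \<Rightarrow> int \<Rightarrow> int \<Rightarrow> bqf" where
  "bqf_of p q r = (\<lambda>v. p * (v $ 1)^2 + q * v $ 1 * v $ 2 + r * (v $ 2)^2)"

text \<open>Primitive forms of discriminant \<open>\<Delta>\<close>. For \<open>\<Delta> < 0\<close> only positive definite forms are taken, so
  that the classes are those of the narrow class group of \<open>\<rat>(\<surd>\<Delta>)\<close>.\<close>

definition forms :: "int \<Rightarrow> bqf set" where
  "forms \<Delta> = {bqf_of p q r | p q r. Gcd {p, q, r} = 1 \<and> q^2 - 4 * p * r = \<Delta> \<and> (\<Delta> < 0 \<longrightarrow> p > 0)}"

definition SL2Z :: "(int ^ 2 ^ 2) set" where
  "SL2Z = {M. det M = 1}"

definition form_rel :: "int \<Rightarrow> (bqf \<times> bqf) set" where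
  "form_rel \<Delta> = {(f, g). f \<in> forms \<Delta> \<and> g \<in> forms \<Delta> \<and> (\<exists>M\<in>SL2Z. g = (\<lambda>v. f (M *v v)))}"

definition form_class :: "int \<Rightarrow> bqf \<Rightarrow> bqf set" where
  "form_class \<Delta> f = form_rel \<Delta> `` {f}"

text \<open>Gauss's direct composition: \<open>f(v) g(w) = h(B\<^sub>1(v, w), B\<^sub>2(v, w))\<close> with
  \<open>B\<^sub>i(v, w) = a\<^sub>i v\<^sub>1 w\<^sub>1 + b\<^sub>i v\<^sub>1 w\<^sub>2 + c\<^sub>i v\<^sub>2 w\<^sub>1 + d\<^sub>i v\<^sub>2 w\<^sub>2\<close>. The two sign conditions make the
  composition direct; without them \<open>h\<close> would be determined only up to replacing \<open>f\<close> or \<open>g\<close> by its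
  inverse.\<close>

definition direct_composition :: "bqf \<Rightarrow> bqf \<Rightarrow> bqf \<Rightarrow> bool" where
  "direct_composition f g h \<longleftrightarrow>
     (\<exists>a1 b1 c1 d1 a2 b2 c2 d2 :: int.
        (\<forall>v w. f v * g w =
           h (vector
             [a1 * v$1 * w$1 + b1 * v$1 * w$2 + c1 * v$2 * w$1 + d1 * v$2 * w$2,
              a2 * v$1 * w$1 + b2 * v$1 * w$2 + c2 * v$2 * w$1 + d2 * v$2 * w$2])) \<and>
        a1 * b2 - a2 * b1 = f (vector [1, 0]) \<and>
        a1 * c2 - a2 * c1 = g (vector [1, 0]))"

definition principal_form :: "int \<Rightarrow> bqf" where
  "principal_form \<Delta> = bqf_of 1 (\<Delta> mod 2) ((\<Delta> mod 2 - \<Delta>) div 4)"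

definition narrow_class_group :: "int \<Rightarrow> bqf set monoid" where
  "narrow_class_group \<Delta> =
     \<lparr>carrier = forms \<Delta> // form_rel \<Delta>,
      monoid.mult = (\<lambda>X Y. {h \<in> forms \<Delta>. \<exists>f\<in>X. \<exists>g\<in>Y. direct_composition f g h}),
      one = form_class \<Delta> (principal_form \<Delta>)\<rparr>"


section \<open>Cubes\<close>

type_synonym cube = "(int ^ 2 ^ 2) \<times> (int ^ 2 ^ 2)"

fun Q1 :: "cube \<Rightarrow> bqf" where
  "Q1 (A, B) = (\<lambda>v. - det (\<chi> i j. A $ i $ j * v $ 1 + B $ i $ j * v $ 2))"

text \<open>\<open>vector\<close> lists rows, so the transpose puts the two vectors in the columns.\<close>

fun Q2 :: "cube \<Rightarrow> bqf" where
  "Q2 (A, B) = (\<lambda>v. - det (transpose (vector [A *v v, B *v v]) :: int ^ 2 ^ 2))"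

fun Q3 :: "cube \<Rightarrow> bqf" where
  "Q3 (A, B) = (\<lambda>v. - det (transpose (vector [transpose A *v v, transpose B *v v]) :: int ^ 2 ^ 2))"

text \<open>The three factors of \<open>SL\<^sub>2(\<int>)\<^sup>3\<close> act on the cube along its three directions: on the pair
  \<open>(A, B)\<close>, on the columns and on the rows of both matrices.\<close>

fun cube_act ::
    "(int ^ 2 ^ 2) \<times> (int ^ 2 ^ 2) \<times> (int ^ 2 ^ 2) \<Rightarrow> cube \<Rightarrow> cube" where
  "cube_act (M, N, R) (A, B) =
     (R ** (\<chi> i j. M $ 1 $ 1 * A $ i $ j + M $ 1 $ 2 * B $ i $ j) ** transpose N,
      R ** (\<chi> i j. M $ 2 $ 1 * A $ i $ j + M $ 2 $ 2 * B $ i $ j) ** transpose N)"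

definition cubes :: "int \<Rightarrow> cube set" where
  "cubes \<Delta> = {C. Q1 C \<in> forms \<Delta> \<and> Q2 C \<in> forms \<Delta> \<and> Q3 C \<in> forms \<Delta>}"

definition cube_rel :: "int \<Rightarrow> (cube \<times> cube) set" where
  "cube_rel \<Delta> =
     {(C, C'). C \<in> cubes \<Delta> \<and> C' \<in> cubes \<Delta> \<and> (\<exists>\<gamma> \<in> SL2Z \<times> SL2Z \<times> SL2Z. C' = cube_act \<gamma> C)}"

definition cube_class :: "int \<Rightarrow> cube \<Rightarrow> cube set" where
  "cube_class \<Delta> C = cube_rel \<Delta> `` {C}"

text \<open>The map \<open>[C] \<mapsto> ([Q\<^sub>1 C], [Q\<^sub>2 C])\<close>. All members of a class have the same image, so the unions
  range over a single set.\<close>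

definition cube_phi :: "int \<Rightarrow> cube set \<Rightarrow> bqf set \<times> bqf set" where
  "cube_phi \<Delta> X = (\<Union>C\<in>X. form_class \<Delta> (Q1 C), \<Union>C\<in>X. form_class \<Delta> (Q2 C))"

text \<open>Bhargava's group: by his theorem \<open>cube_phi\<close> is a bijection from the classes of cubes to
  the product of two copies of the narrow class group, and the group law is the one that makes it an
  isomorphism.\<close>

definition cube_class_group :: "int \<Rightarrow> cube set monoid" where
  "cube_class_group \<Delta> =
     (let S = cubes \<Delta> // cube_rel \<Delta>;
          H = narrow_class_group \<Delta> \<times>\<times> narrow_class_group \<Delta>
      in \<lparr>carrier = S,
          monoid.mult = (\<lambda>X Y. inv_into S (cube_phi \<Delta>) (cube_phi \<Delta> X \<otimes>\<^bsub>H\<^esub> cube_phi \<Delta> Y)),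
          one = inv_into S (cube_phi \<Delta>) \<one>\<^bsub>H\<^esub>\<rparr>)"

definition form_cube :: "int \<Rightarrow> int \<Rightarrow> int \<Rightarrow> int \<Rightarrow> cube" where
  "form_cube a b c d =
     (vector [vector [3 * a, b], vector [b, c]], vector [vector [b, c], vector [c, 3 * d]])"

text \<open>For \<open>D \<equiv> 0 (mod 4)\<close> the upper right entry of the second matrix is \<open>0\<close>: the cube has discriminant
  \<open>e\<^sup>2 - 3 D\<close> if that entry is \<open>e\<close>, and it is to have discriminant \<open>-3 D\<close>.\<close>

definition disc_cube :: "int \<Rightarrow> cube" where
  "disc_cube D =
     (vector [vector [0, 3], vector [1, 0]],
      if [D = 1] (mod 4) then vector [vector [(D + 3) div 4, 3], vector [0, -1]]
      else vector [vector [D div 4, 0], vector [0, -1]])"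

end

theory Submission
  imports Defs
begin

text \<open>
  The first two forms of \<open>\<K>\<^sub>F\<close> are the Hessian \<open>H\<close> of \<open>F\<close>, and on \<open>O\<^sub>K\<^sup>0\<close> the half trace form is
  \<open>H / 3\<close>. Up to a unimodular substitution, \<open>H = (3 p, 3 s, r)\<close> and the half trace form is
  \<open>q = (p, 3 s, 3 r)\<close>. This is the direct composition of \<open>H\<close> with \<open>(3, 3 s, p r)\<close>, which lies in
  the ambiguous class shared by the first two forms of \<open>\<C>\<close>. The group law on cubes is transported
  along \<open>\<phi>\<close>, so it remains to see that the pair of classes \<open>([q], [q])\<close> is in the image of \<open>\<phi>\<close>,
  for which a cube is written down explicitly. All forms of discriminant \<open>-3 d\<^sub>K\<close> are primitive
  because \<open>d\<^sub>K\<close> is fundamental and prime to 3.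
\<close>

section \<open>Binary quadratic forms and direct composition\<close>

text \<open>Modulo 3 the Hessian is the square of b x - c y, and n \<alpha>0 + p \<beta>0 is
  integral exactly when 3 divides \<open>b * n - c * p\<close>. So the double root of the Hessian
  modulo 3 and the lattice of trace-zero integers are the same datum. As 3 does not divide the
  discriminant, (b : c) is a point of the projective line over F_3, and its four values give the
  four bases of the statement. The form (3, 3 e, m) is the class of the ramified prime above 3 in
  the quadratic field; composing with it removes the factor 3 from the leading coefficient of the
  Hessian. Two definitions shape the proof. A product of form classes is the set of all direct
  compositions of representatives, so this set must be shown to be a single class: the bilinear
  substitution is recovered, up to SL2(Z), from its six 2x2 minors, which the two factors determine.
  A product of cube classes is a value of \<open>inv_into\<close>, which is meaningful only on the
  range of \<phi>; hence the explicit cube. Orientation is respected throughout, so the sign in the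
  exponent comes out as +1.\<close>

lemma vec2_eq: "(v :: 'b::zero ^ 2) = vector [v $ 1, v $ 2]"
  by (simp add: vec_eq_iff forall_2)

lemma bqf_of_vector [simp]: "bqf_of p q r (vector [x, y]) = p * x^2 + q * x * y + r * y^2"
  by (simp add: bqf_of_def)

lemma formsE:
  assumes "f \<in> forms \<Delta>"
  obtains p q r where "f = bqf_of p q r" "Gcd {p, q, r} = 1" "q^2 - 4 * p * r = \<Delta>" "\<Delta> < 0 \<Longrightarrow> p > 0"
  using assms unfolding forms_def by blast

lemma binary_coeffs_eq:
  fixes p q r p' q' r' :: int
  assumes "\<And>x y. p * x^2 + q * x * y + r * y^2 = p' * x^2 + q' * x * y + r' * y^2"
  shows "p = p'" "q = q'" "r = r'"
  using assms[of 1 0] assms[of 0 1] assms[of 1 1] by auto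

text \<open>Entries instead of matrices turn every later equivalence of forms into a polynomial
  identity in two variables.\<close>

lemma form_rel_iff:
  "(f, g) \<in> form_rel \<Delta> \<longleftrightarrow> f \<in> forms \<Delta> \<and> g \<in> forms \<Delta> \<and>
     (\<exists>k l m n. k * n - l * m = 1 \<and>
        (\<forall>x y. g (vector [x, y]) = f (vector [k * x + l * y, m * x + n * y])))"
  (is "?L \<longleftrightarrow> ?R")
proof
  assume ?L
  then obtain M where M: "f \<in> forms \<Delta>" "g \<in> forms \<Delta>" "M \<in> SL2Z" "g = (\<lambda>v. f (M *v v))"
    by (auto simp: form_rel_def)
  have "M *v vector [x, y] = vector [M$1$1 * x + M$1$2 * y, M$2$1 * x + M$2$2 * y]" for x y
    by (simp add: vec_eq_iff forall_2 matrix_vector_mult_def sum_2)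
  moreover have "M$1$1 * M$2$2 - M$1$2 * M$2$1 = 1"
    using M(3) by (simp add: SL2Z_def det_2)
  ultimately show ?R using M by metis
next
  assume ?R
  then obtain k l m n where M: "f \<in> forms \<Delta>" "g \<in> forms \<Delta>" "k * n - l * m = 1"
     "\<And>x y. g (vector [x, y]) = f (vector [k * x + l * y, m * x + n * y])" by blast
  define M :: "int^2^2" where "M = vector [vector [k, l], vector [m, n]]"
  have "M \<in> SL2Z" using M(3) by (simp add: SL2Z_def det_2 M_def)
  moreover have "g v = f (M *v v)" for v
  proof -
    have "M *v v = vector [k * v$1 + l * v$2, m * v$1 + n * v$2]"
      by (simp add: vec_eq_iff forall_2 matrix_vector_mult_def sum_2 M_def)
    thus ?thesis using M(4)[of "v$1" "v$2"] vec2_eq[of v] by simp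
  qed
  ultimately show ?L using M by (auto simp: form_rel_def)
qed

lemma form_relI:
  assumes "f \<in> forms \<Delta>" "g \<in> forms \<Delta>" "k * n - l * m = 1"
    "\<And>x y. g (vector [x, y]) = f (vector [k * x + l * y, m * x + n * y])"
  shows "(f, g) \<in> form_rel \<Delta>"
  using assms form_rel_iff by blast

lemma form_relE:
  assumes "(f, g) \<in> form_rel \<Delta>"
  obtains k l m n where "f \<in> forms \<Delta>" "g \<in> forms \<Delta>" "k * n - l * m = 1"
    "\<And>x y. g (vector [x, y]) = f (vector [k * x + l * y, m * x + n * y])"
  using assms form_rel_iff by blast

lemma equiv_form_rel: "equiv (forms \<Delta>) (form_rel \<Delta>)"
proof (rule equivI)
  show "form_rel \<Delta> \<subseteq> forms \<Delta> \<times> forms \<Delta>" by (auto simp: form_rel_def)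
  show "refl_on (forms \<Delta>) (form_rel \<Delta>)"
    by (auto intro!: refl_onI form_relI[of _ _ _ 1 1 0 0])
  show "sym (form_rel \<Delta>)"
  proof (rule symI)
    fix f g assume "(f, g) \<in> form_rel \<Delta>"
    then obtain k l m n where *: "f \<in> forms \<Delta>" "g \<in> forms \<Delta>" "k * n - l * m = 1"
      "\<And>x y. g (vector [x, y]) = f (vector [k * x + l * y, m * x + n * y])" by (elim form_relE) blast
    show "(g, f) \<in> form_rel \<Delta>"
    proof (rule form_relI[OF *(2,1), of n k "-l" "-m"])
      show "n * k - - l * - m = 1" using *(3) by (simp add: algebra_simps)
      fix x y
      have "k * (n * x + - l * y) + l * (- m * x + k * y) = (k * n - l * m) * x"
        "m * (n * x + - l * y) + n * (- m * x + k * y) = (k * n - l * m) * y"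
        by (simp_all add: algebra_simps)
      thus "f (vector [x, y]) = g (vector [n * x + - l * y, - m * x + k * y])"
        by (simp only: * mult_1_left)
    qed
  qed
  show "trans (form_rel \<Delta>)"
  proof (rule transI)
    fix f g h assume "(f, g) \<in> form_rel \<Delta>" "(g, h) \<in> form_rel \<Delta>"
    then obtain k l m n k' l' m' n' where *: "f \<in> forms \<Delta>" "g \<in> forms \<Delta>" "h \<in> forms \<Delta>"
      "k * n - l * m = 1" "k' * n' - l' * m' = 1"
      "\<And>x y. g (vector [x, y]) = f (vector [k * x + l * y, m * x + n * y])"
      "\<And>x y. h (vector [x, y]) = g (vector [k' * x + l' * y, m' * x + n' * y])"
      by (elim form_relE) blast
    show "(f, h) \<in> form_rel \<Delta>"
    proof (rule form_relI[OF *(1,3), where k = "k*k' + l*m'" and l = "k*l' + l*n'"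
          and m = "m*k' + n*m'" and n = "m*l' + n*n'"])
      have "(k*k' + l*m') * (m*l' + n*n') - (k*l' + l*n') * (m*k' + n*m')
          = (k * n - l * m) * (k' * n' - l' * m')" by (simp add: algebra_simps)
      thus "(k*k' + l*m') * (m*l' + n*n') - (k*l' + l*n') * (m*k' + n*m') = 1" using * by simp
      fix x y
      show "h (vector [x, y]) = f (vector [(k*k' + l*m') * x + (k*l' + l*n') * y,
          (m*k' + n*m') * x + (m*l' + n*n') * y])"
        unfolding * by (simp add: algebra_simps)
    qed
  qed
qed

lemma form_class_eq_iff:
  assumes "f \<in> forms \<Delta>" "g \<in> forms \<Delta>"
  shows "form_class \<Delta> f = form_class \<Delta> g \<longleftrightarrow> (f, g) \<in> form_rel \<Delta>"
  unfolding form_class_def using eq_equiv_class_iff[OF equiv_form_rel assms] .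

section \<open>Direct composition and its uniqueness up to equivalence\<close>

lemma direct_composition_iff:
  "direct_composition f g h \<longleftrightarrow>
     (\<exists>a1 b1 c1 d1 a2 b2 c2 d2 :: int.
        (\<forall>x y z w. f (vector [x, y]) * g (vector [z, w]) =
           h (vector
             [a1 * x * z + b1 * x * w + c1 * y * z + d1 * y * w,
              a2 * x * z + b2 * x * w + c2 * y * z + d2 * y * w])) \<and>
        a1 * b2 - a2 * b1 = f (vector [1, 0]) \<and>
        a1 * c2 - a2 * c1 = g (vector [1, 0]))"
proof -
  have "(\<forall>v w. P v w) \<longleftrightarrow> (\<forall>x y z t. P (vector [x, y]) (vector [z, t]))" for P :: "int^2 \<Rightarrow> int^2 \<Rightarrow> bool"
    by (metis vec2_eq)
  thus ?thesis unfolding direct_composition_def by (simp only:) simp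
qed

lemma disc_subst:
  fixes p q r k l m n :: int
  shows "(2 * p * k * l + q * (k * n + l * m) + 2 * r * m * n)^2
     - 4 * (p * k^2 + q * k * m + r * m^2) * (p * l^2 + q * l * n + r * n^2)
     = (k * n - l * m)^2 * (q^2 - 4 * p * r)"
  by (simp add: algebra_simps power2_eq_square)

text \<open>Equal squares leave only a global sign free, and the common nonzero leading coefficient
  fixes it.\<close>

lemma square_quadratic_eq:
  fixes p q r q' r' :: int
  assumes "p \<noteq> 0" "\<And>x y. (p * x^2 + q' * x * y + r' * y^2)^2 = (p * x^2 + q * x * y + r * y^2)^2"
  shows "q' = q" "r' = r"
proof -
  define A B C D where "A = 2 * p * (q' - q)" "B = (q'^2 + 2 * p * r') - (q^2 + 2 * p * r)"
    "C = 2 * (q' * r' - q * r)" "D = r'^2 - r^2"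
  note defs = this
  have e: "A * t + B * t^2 + C * t^3 + D * t^4 = 0" for t
  proof -
    have "A * t + B * t^2 + C * t^3 + D * t^4 = (p + q' * t + r' * t^2)^2 - (p + q * t + r * t^2)^2"
      unfolding defs by (simp add: power2_eq_square power3_eq_cube power4_eq_xxxx algebra_simps)
    thus ?thesis using assms(2)[of 1 t] by simp
  qed
  \<comment> \<open>The signs of \<open>t\<close> separate the odd coefficients \<open>A\<close>,
    \<open>C\<close> from the even ones \<open>B\<close>, \<open>D\<close>; two absolute values then
    determine each pair.\<close>
  have "A = 0" "B = 0" using e[of 1] e[of "-1"] e[of 2] e[of "-2"] by auto
  thus "q' = q" "r' = r" unfolding defs using assms(1) by auto
qed

text \<open>For fixed \<open>v\<close>, let \<open>\<delta>(v)\<close> be the determinant of \<open>w \<mapsto> B(v, w)\<close>. Comparing the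
  discriminants of both sides as forms in \<open>w\<close> gives \<open>\<delta>\<^sup>2 = f\<^sup>2\<close>, and the sign condition at
  \<open>(1, 0)\<close> selects \<open>\<delta> = f\<close>.\<close>

lemma composition_minors_left:
  fixes p q r p' q' r' P Q R a1 b1 c1 d1 a2 b2 c2 d2 \<Delta> :: int
  assumes comp: "\<And>x y z w. (p * x^2 + q * x * y + r * y^2) * (p' * z^2 + q' * z * w + r' * w^2)
       = bqf_of P Q R (vector [a1 * x * z + b1 * x * w + c1 * y * z + d1 * y * w,
              a2 * x * z + b2 * x * w + c2 * y * z + d2 * y * w])"
    and disc: "q'^2 - 4 * p' * r' = \<Delta>" "Q^2 - 4 * P * R = \<Delta>" "\<Delta> \<noteq> 0"
    and "p \<noteq> 0" "a1 * b2 - a2 * b1 = p"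
  shows "(a1 * d2 - a2 * d1) - (b1 * c2 - b2 * c1) = q" "c1 * d2 - c2 * d1 = r"
proof -
  let ?q = "(a1 * d2 - a2 * d1) - (b1 * c2 - b2 * c1)" and ?r = "c1 * d2 - c2 * d1"
  have *: "(p * x^2 + ?q * x * y + ?r * y^2)^2 = (p * x^2 + q * x * y + r * y^2)^2" for x y
  proof -
    define k l m n where kl: "k = a1 * x + c1 * y" "l = b1 * x + d1 * y" "m = a2 * x + c2 * y" "n = b2 * x + d2 * y"
    define F where "F = p * x^2 + q * x * y + r * y^2"
    have "(P * k^2 + Q * k * m + R * m^2) * z^2 + (2 * P * k * l + Q * (k * n + l * m) + 2 * R * m * n) * z * w
        + (P * l^2 + Q * l * n + R * n^2) * w^2 = (F * p') * z^2 + (F * q') * z * w + (F * r') * w^2" for z w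
    proof -
      have "(F * p') * z^2 + (F * q') * z * w + (F * r') * w^2 = F * (p' * z^2 + q' * z * w + r' * w^2)"
        by (simp add: algebra_simps)
      also have "\<dots> = bqf_of P Q R (vector [k * z + l * w, m * z + n * w])"
        unfolding F_def comp kl by (simp add: algebra_simps)
      finally show ?thesis by (simp add: algebra_simps power2_eq_square)
    qed
    from binary_coeffs_eq[OF this]
    have "(k * n - l * m)^2 * (Q^2 - 4 * P * R) = (F * q')^2 - 4 * (F * p') * (F * r')"
      using disc_subst[of P k l Q n m R] by simp
    also have "\<dots> = F^2 * (q'^2 - 4 * p' * r')" by (simp add: algebra_simps power2_eq_square)
    finally have "(k * n - l * m)^2 = F^2" using disc by simp
    moreover have "k * n - l * m = p * x^2 + ?q * x * y + ?r * y^2"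
      unfolding kl assms(6)[symmetric] by (simp add: algebra_simps power2_eq_square)
    ultimately show ?thesis by (simp add: F_def)
  qed
  show "?q = q" "?r = r" using square_quadratic_eq[OF \<open>p \<noteq> 0\<close> *] by auto
qed

text \<open>The one-sided version is applied to both orders of the factors; exchanging them
  exchanges the columns b and c. Together the factors fix all six minors, since the minors of the
  columns a, d and b, c have sum q' and difference q.\<close>

lemma composition_minors:
  fixes p q r p' q' r' P Q R a1 b1 c1 d1 a2 b2 c2 d2 \<Delta> :: int
  assumes comp: "\<And>x y z w. (p * x^2 + q * x * y + r * y^2) * (p' * z^2 + q' * z * w + r' * w^2)
       = bqf_of P Q R (vector [a1 * x * z + b1 * x * w + c1 * y * z + d1 * y * w,
              a2 * x * z + b2 * x * w + c2 * y * z + d2 * y * w])"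
    and disc: "q^2 - 4 * p * r = \<Delta>" "q'^2 - 4 * p' * r' = \<Delta>" "Q^2 - 4 * P * R = \<Delta>" "\<Delta> \<noteq> 0"
    and nz: "p \<noteq> 0" "p' \<noteq> 0" and mi: "a1 * b2 - a2 * b1 = p" "a1 * c2 - a2 * c1 = p'"
  shows "(a1 * d2 - a2 * d1) - (b1 * c2 - b2 * c1) = q" "c1 * d2 - c2 * d1 = r"
    "(a1 * d2 - a2 * d1) + (b1 * c2 - b2 * c1) = q'" "b1 * d2 - b2 * d1 = r'"
proof -
  show "(a1 * d2 - a2 * d1) - (b1 * c2 - b2 * c1) = q" "c1 * d2 - c2 * d1 = r"
    using composition_minors_left[OF comp disc(2,3,4) nz(1) mi(1)] by auto
  have "(p' * x^2 + q' * x * y + r' * y^2) * (p * z^2 + q * z * w + r * w^2)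
       = bqf_of P Q R (vector [a1 * x * z + c1 * x * w + b1 * y * z + d1 * y * w,
              a2 * x * z + c2 * x * w + b2 * y * z + d2 * y * w])" for x y z w
    using comp[of z w x y] by (simp add: algebra_simps)
  from composition_minors_left[OF this disc(1,3,4) nz(2) mi(2)]
  show "(a1 * d2 - a2 * d1) + (b1 * c2 - b2 * c1) = q'" "b1 * d2 - b2 * d1 = r'"
    by (auto simp: algebra_simps)
qed

lemma Gcd_three_bezout:
  fixes p q r :: int
  assumes "Gcd {p, q, r} = 1"
  obtains u v w where "u * p + v * q + w * r = 1"
proof -
  obtain s t where 1: "s * q + t * r = gcd q r" using bezout_int by blast
  obtain s' t' where 2: "s' * p + t' * gcd q r = gcd p (gcd q r)" using bezout_int by blast
  have "gcd p (gcd q r) = 1" using assms by simp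
  with 1 2 have "s' * p + (t' * s) * q + (t' * t) * r = 1" by (metis add.assoc distrib_left mult.assoc)
  thus thesis by (rule that)
qed

text \<open>The transition matrix \<open>(k, l; m, n)\<close> is the combination of the products \<open>A'\<^sub>I adj A\<^sub>I\<close>
  over the \<open>2 \<times> 2\<close> blocks \<open>I\<close> with the Bezout coefficients of the minors.\<close>

lemma same_minors_SL2:
  fixes a1 b1 c1 d1 a2 b2 c2 d2 :: int
  assumes eq: "a1 * b2 - a2 * b1 = A1 * B2 - A2 * B1" "a1 * c2 - a2 * c1 = A1 * C2 - A2 * C1"
    "a1 * d2 - a2 * d1 = A1 * D2 - A2 * D1" "b1 * c2 - b2 * c1 = B1 * C2 - B2 * C1"
    "b1 * d2 - b2 * d1 = B1 * D2 - B2 * D1" "c1 * d2 - c2 * d1 = C1 * D2 - C2 * D1"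
    and bez: "u * (a1 * b2 - a2 * b1) + v * ((a1 * d2 - a2 * d1) - (b1 * c2 - b2 * c1)) + w * (c1 * d2 - c2 * d1) = 1"
    and nz: "a1 * b2 - a2 * b1 \<noteq> 0"
  obtains k l m n where "k * n - l * m = 1"
    "A1 = k * a1 + l * a2" "A2 = m * a1 + n * a2" "B1 = k * b1 + l * b2" "B2 = m * b1 + n * b2"
    "C1 = k * c1 + l * c2" "C2 = m * c1 + n * c2" "D1 = k * d1 + l * d2" "D2 = m * d1 + n * d2"
proof -
  define row where "row a b c d =
     (u * (a * b2 - b * a2) + v * ((a * d2 - d * a2) - (b * c2 - c * b2)) + w * (c * d2 - d * c2),
      u * (b * a1 - a * b1) + v * ((d * a1 - a * d1) - (c * b1 - b * c1)) + w * (d * c1 - c * d1))" for a b c d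
  obtain k l where kl: "row A1 B1 C1 D1 = (k, l)" by fastforce
  obtain m n where mn: "row A2 B2 C2 D2 = (m, n)" by fastforce
  note kl' = kl[unfolded row_def prod.inject, THEN conjunct1, symmetric] kl[unfolded row_def prod.inject, THEN conjunct2, symmetric]
  note mn' = mn[unfolded row_def prod.inject, THEN conjunct1, symmetric] mn[unfolded row_def prod.inject, THEN conjunct2, symmetric]
  have bez': "u * (A1 * B2 - A2 * B1) + v * ((A1 * D2 - A2 * D1) - (B1 * C2 - B2 * C1)) + w * (C1 * D2 - C2 * D1) = 1"
    using bez unfolding eq .
  \<comment> \<open>Cramer's rule for one column: the minors of (x1, x2) against the four columns
    occur linearly and are exchanged for those of (X, Y); what remains is X, respectively Y, times
    the Bezout sum.\<close>
  have col: "X = k * x1 + l * x2" "Y = m * x1 + n * x2"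
    if *: "a1 * x2 - a2 * x1 = A1 * Y - A2 * X" "b1 * x2 - b2 * x1 = B1 * Y - B2 * X"
      "c1 * x2 - c2 * x1 = C1 * Y - C2 * X" "d1 * x2 - d2 * x1 = D1 * Y - D2 * X" for x1 x2 X Y
  proof -
    have "k * x1 + l * x2 = u * (B1 * (a1 * x2 - a2 * x1) - A1 * (b1 * x2 - b2 * x1))
      + v * (D1 * (a1 * x2 - a2 * x1) - A1 * (d1 * x2 - d2 * x1) - C1 * (b1 * x2 - b2 * x1) + B1 * (c1 * x2 - c2 * x1))
      + w * (D1 * (c1 * x2 - c2 * x1) - C1 * (d1 * x2 - d2 * x1))"
      unfolding kl' by (simp add: algebra_simps)
    also have "\<dots> = X * (u * (A1 * B2 - A2 * B1) + v * ((A1 * D2 - A2 * D1) - (B1 * C2 - B2 * C1)) + w * (C1 * D2 - C2 * D1))"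
      unfolding * by (simp add: algebra_simps)
    finally show "X = k * x1 + l * x2" using bez' by simp
    have "m * x1 + n * x2 = u * (B2 * (a1 * x2 - a2 * x1) - A2 * (b1 * x2 - b2 * x1))
      + v * (D2 * (a1 * x2 - a2 * x1) - A2 * (d1 * x2 - d2 * x1) - C2 * (b1 * x2 - b2 * x1) + B2 * (c1 * x2 - c2 * x1))
      + w * (D2 * (c1 * x2 - c2 * x1) - C2 * (d1 * x2 - d2 * x1))"
      unfolding mn' by (simp add: algebra_simps)
    also have "\<dots> = Y * (u * (A1 * B2 - A2 * B1) + v * ((A1 * D2 - A2 * D1) - (B1 * C2 - B2 * C1)) + w * (C1 * D2 - C2 * D1))"
      unfolding * by (simp add: algebra_simps)
    finally show "Y = m * x1 + n * x2" using bez' by simp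
  qed
  have eA: "A1 = k * a1 + l * a2" "A2 = m * a1 + n * a2"
    using col[of a2 a1 A2 A1] eq by (auto simp: mult.commute)
  have eB: "B1 = k * b1 + l * b2" "B2 = m * b1 + n * b2"
    using col[of b2 b1 B2 B1] eq by (auto simp: mult.commute)
  have eC: "C1 = k * c1 + l * c2" "C2 = m * c1 + n * c2"
    using col[of c2 c1 C2 C1] eq by (auto simp: mult.commute)
  have eD: "D1 = k * d1 + l * d2" "D2 = m * d1 + n * d2"
    using col[of d2 d1 D2 D1] eq by (auto simp: mult.commute)
  have "A1 * B2 - A2 * B1 = (k * n - l * m) * (a1 * b2 - a2 * b1)"
    unfolding eA eB by (simp add: algebra_simps)
  hence "k * n - l * m = 1" using eq(1) nz by simp
  thus thesis using that eA eB eC eD by blast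
qed

text \<open>A zero leading coefficient would make the discriminant the square \<open>q^2\<close>.
  Nonzero leading coefficients are what lets the sign conditions at (1, 0) decide the sign
  everywhere.\<close>

lemma nonsquare_coeff:
  fixes p q r \<Delta> :: int
  assumes "q^2 - 4 * p * r = \<Delta>" "\<And>k. k^2 \<noteq> \<Delta>"
  shows "p \<noteq> 0" "\<Delta> \<noteq> 0"
  using assms by (auto, metis zero_power2)

text \<open>Both bilinear substitutions have the same six minors, and primitivity of
  \<open>f\<close> supplies a Bezout relation among them. So the substitutions differ by a matrix of
  SL2(Z), which then relates the two products.\<close>

lemma direct_composition_unique:
  assumes fo: "f \<in> forms \<Delta>" "g \<in> forms \<Delta>" "h \<in> forms \<Delta>" "h' \<in> forms \<Delta>"
    and ns: "\<And>k. k^2 \<noteq> \<Delta>"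
    and c: "direct_composition f g h" and c': "direct_composition f g h'"
  shows "(h', h) \<in> form_rel \<Delta>"
proof -
  obtain p q r where f: "f = bqf_of p q r" "Gcd {p, q, r} = 1" "q^2 - 4 * p * r = \<Delta>" using fo(1) by (elim formsE)
  obtain p' q' r' where g: "g = bqf_of p' q' r'" "q'^2 - 4 * p' * r' = \<Delta>" using fo(2) by (elim formsE)
  obtain P Q R where h: "h = bqf_of P Q R" "Q^2 - 4 * P * R = \<Delta>" using fo(3) by (elim formsE)
  obtain P' Q' R' where h': "h' = bqf_of P' Q' R'" "Q'^2 - 4 * P' * R' = \<Delta>" using fo(4) by (elim formsE)
  note nz = nonsquare_coeff[OF f(3) ns] nonsquare_coeff(1)[OF g(2) ns]
  obtain a1 b1 c1 d1 a2 b2 c2 d2 where B: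
    "\<And>x y z w. f (vector [x, y]) * g (vector [z, w]) =
           h (vector [a1 * x * z + b1 * x * w + c1 * y * z + d1 * y * w,
              a2 * x * z + b2 * x * w + c2 * y * z + d2 * y * w])"
    "a1 * b2 - a2 * b1 = p" "a1 * c2 - a2 * c1 = p'"
    using c unfolding direct_composition_iff f g by auto
  obtain A1 B1 C1 D1 A2 B2 C2 D2 where B':
    "\<And>x y z w. f (vector [x, y]) * g (vector [z, w]) =
           h' (vector [A1 * x * z + B1 * x * w + C1 * y * z + D1 * y * w,
              A2 * x * z + B2 * x * w + C2 * y * z + D2 * y * w])"
    "A1 * B2 - A2 * B1 = p" "A1 * C2 - A2 * C1 = p'"
    using c' unfolding direct_composition_iff f g by auto
  note m = composition_minors[OF B(1)[unfolded f g h bqf_of_vector[of p q r] bqf_of_vector[of p' q' r']] f(3) g(2) h(2) nz(2,1,3) B(2,3)]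
  note m' = composition_minors[OF B'(1)[unfolded f g h' bqf_of_vector[of p q r] bqf_of_vector[of p' q' r']] f(3) g(2) h'(2) nz(2,1,3) B'(2,3)]
  obtain u v t where bez: "u * p + v * q + t * r = 1" using Gcd_three_bezout[OF f(2)] .
  obtain k l i n where N: "k * n - l * i = 1"
    "A1 = k * a1 + l * a2" "A2 = i * a1 + n * a2" "B1 = k * b1 + l * b2" "B2 = i * b1 + n * b2"
    "C1 = k * c1 + l * c2" "C2 = i * c1 + n * c2" "D1 = k * d1 + l * d2" "D2 = i * d1 + n * d2"
    by (rule same_minors_SL2[of a1 b2 a2 b1 A1 B2 A2 B1 c2 c1 C2 C1 d2 d1 D2 D1 u v t])
      (use m m' B(2,3) B'(2,3) bez nz in auto)
  show ?thesis
  proof (rule form_relI[OF fo(4,3) N(1)])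
    fix x y
    \<comment> \<open>Cramer's rule: the arguments (1, 0) and (z, w) are sent to p (x, y). Both
      products are homogeneous of degree 2, so \<open>p^2\<close> cancels at the end.\<close>
    define z w where zw: "z = b2 * x - b1 * y" "w = a1 * y - a2 * x"
    have 1: "a1 * z + b1 * w = p * x" "a2 * z + b2 * w = p * y"
      unfolding zw B(2)[symmetric] by (simp_all add: algebra_simps)
    have 2: "A1 * z + B1 * w = k * (a1 * z + b1 * w) + l * (a2 * z + b2 * w)"
      "A2 * z + B2 * w = i * (a1 * z + b1 * w) + n * (a2 * z + b2 * w)"
      unfolding N by (simp_all add: algebra_simps)
    have "h (vector [p * x, p * y]) = h' (vector [k * (p * x) + l * (p * y), i * (p * x) + n * (p * y)])"
      using B(1)[of 1 0 z w] B'(1)[of 1 0 z w] 1 2 by simp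
    hence "p^2 * h (vector [x, y]) = p^2 * h' (vector [k * x + l * y, i * x + n * y])"
      unfolding h h' by (simp add: algebra_simps power2_eq_square)
    thus "h (vector [x, y]) = h' (vector [k * x + l * y, i * x + n * y])" using nz by simp
  qed
qed

text \<open>The sign condition for \<open>g\<close> survives because the substitution has
  determinant 1. The one for \<open>f'\<close> asks for the determinant at the new vector (k, m),
  and \<open>composition_minors\<close> identifies it with the value of \<open>f\<close>
  there.\<close>

lemma direct_composition_left:
  assumes rel: "(f, f') \<in> form_rel \<Delta>" and fo: "g \<in> forms \<Delta>" "h \<in> forms \<Delta>"
    and ns: "\<And>k. k^2 \<noteq> \<Delta>" and c: "direct_composition f g h"
  shows "direct_composition f' g h"
proof -
  obtain k l m n where fo': "f \<in> forms \<Delta>" "f' \<in> forms \<Delta>" and N: "k * n - l * m = 1"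
    "\<And>x y. f' (vector [x, y]) = f (vector [k * x + l * y, m * x + n * y])"
    using rel by (elim form_relE) blast
  obtain p q r where f: "f = bqf_of p q r" "q^2 - 4 * p * r = \<Delta>" using fo'(1) by (elim formsE)
  obtain p' q' r' where g: "g = bqf_of p' q' r'" "q'^2 - 4 * p' * r' = \<Delta>" using fo(1) by (elim formsE)
  obtain P Q R where h: "h = bqf_of P Q R" "Q^2 - 4 * P * R = \<Delta>" using fo(2) by (elim formsE)
  note nz = nonsquare_coeff[OF f(2) ns] nonsquare_coeff(1)[OF g(2) ns]
  obtain a1 b1 c1 d1 a2 b2 c2 d2 where B:
    "\<And>x y z w. f (vector [x, y]) * g (vector [z, w]) =
           h (vector [a1 * x * z + b1 * x * w + c1 * y * z + d1 * y * w,
              a2 * x * z + b2 * x * w + c2 * y * z + d2 * y * w])"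
    "a1 * b2 - a2 * b1 = p" "a1 * c2 - a2 * c1 = p'"
    using c unfolding direct_composition_iff f g by auto
  note mi = composition_minors[OF B(1)[unfolded f g h bqf_of_vector[of p q r] bqf_of_vector[of p' q' r']] f(2) g(2) h(2) nz(2,1,3) B(2,3)]
  have f'1: "f' (vector [1, 0]) = p * k^2 + q * k * m + r * m^2" using N(2)[of 1 0] f by simp
  have eqs: "(a1 * k + c1 * m) * (b2 * k + d2 * m) - (a2 * k + c2 * m) * (b1 * k + d1 * m) = f' (vector [1, 0])"
    "(a1 * k + c1 * m) * (a2 * l + c2 * n) - (a2 * k + c2 * m) * (a1 * l + c1 * n) = g (vector [1, 0])"
  proof -
    show "(a1 * k + c1 * m) * (b2 * k + d2 * m) - (a2 * k + c2 * m) * (b1 * k + d1 * m) = f' (vector [1, 0])"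
      unfolding f'1 B(2)[symmetric] mi(1)[symmetric] mi(2)[symmetric] by (simp add: algebra_simps power2_eq_square)
    have "(a1 * k + c1 * m) * (a2 * l + c2 * n) - (a2 * k + c2 * m) * (a1 * l + c1 * n)
       = (k * n - l * m) * (a1 * c2 - a2 * c1)" by (simp add: algebra_simps)
    thus "(a1 * k + c1 * m) * (a2 * l + c2 * n) - (a2 * k + c2 * m) * (a1 * l + c1 * n) = g (vector [1, 0])"
      using N(1) B(3) by (simp add: g)
  qed
  show ?thesis unfolding direct_composition_iff
  proof (intro exI conjI allI)
    fix x y z w
    show "f' (vector [x, y]) * g (vector [z, w]) =
      h (vector [(a1 * k + c1 * m) * x * z + (b1 * k + d1 * m) * x * w + (a1 * l + c1 * n) * y * z + (b1 * l + d1 * n) * y * w,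
       (a2 * k + c2 * m) * x * z + (b2 * k + d2 * m) * x * w + (a2 * l + c2 * n) * y * z + (b2 * l + d2 * n) * y * w])"
      unfolding N(2) B(1) by (simp add: algebra_simps)
  qed (use eqs in auto)
qed

lemma direct_composition_sym: "direct_composition f g h \<Longrightarrow> direct_composition g f h"
  unfolding direct_composition_iff
proof (elim exE conjE)
  fix a1 b1 c1 d1 a2 b2 c2 d2 :: int
  assume *: "\<forall>x y z w. f (vector [x, y]) * g (vector [z, w]) =
           h (vector [a1 * x * z + b1 * x * w + c1 * y * z + d1 * y * w,
              a2 * x * z + b2 * x * w + c2 * y * z + d2 * y * w])"
    "a1 * b2 - a2 * b1 = f (vector [1, 0])" "a1 * c2 - a2 * c1 = g (vector [1, 0])"
  show "\<exists>a1 b1 c1 d1 a2 b2 c2 d2 :: int. (\<forall>x y z w. g (vector [x, y]) * f (vector [z, w]) =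
           h (vector [a1 * x * z + b1 * x * w + c1 * y * z + d1 * y * w,
              a2 * x * z + b2 * x * w + c2 * y * z + d2 * y * w])) \<and>
        a1 * b2 - a2 * b1 = g (vector [1, 0]) \<and> a1 * c2 - a2 * c1 = f (vector [1, 0])"
    by (rule exI[of _ a1], rule exI[of _ c1], rule exI[of _ b1], rule exI[of _ d1],
      rule exI[of _ a2], rule exI[of _ c2], rule exI[of _ b2], rule exI[of _ d2])
      (use * in \<open>simp add: algebra_simps\<close>)
qed

lemma direct_composition_result:
  assumes rel: "(h, h') \<in> form_rel \<Delta>" and c: "direct_composition f g h"
  shows "direct_composition f g h'"
proof -
  obtain k l m n where N: "k * n - l * m = 1"
    "\<And>x y. h (vector [x, y]) = h' (vector [k * x + l * y, m * x + n * y])"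
    using equivE[OF equiv_form_rel] rel by (metis form_relE symD)
  obtain a1 b1 c1 d1 a2 b2 c2 d2 where B:
    "\<And>x y z w. f (vector [x, y]) * g (vector [z, w]) =
           h (vector [a1 * x * z + b1 * x * w + c1 * y * z + d1 * y * w,
              a2 * x * z + b2 * x * w + c2 * y * z + d2 * y * w])"
    "a1 * b2 - a2 * b1 = f (vector [1, 0])" "a1 * c2 - a2 * c1 = g (vector [1, 0])"
    using c unfolding direct_composition_iff by auto
  have "(k * a1 + l * a2) * (m * b1 + n * b2) - (m * a1 + n * a2) * (k * b1 + l * b2) = (k * n - l * m) * (a1 * b2 - a2 * b1)"
     "(k * a1 + l * a2) * (m * c1 + n * c2) - (m * a1 + n * a2) * (k * c1 + l * c2) = (k * n - l * m) * (a1 * c2 - a2 * c1)"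
    by (simp_all add: algebra_simps)
  hence eqs: "(k * a1 + l * a2) * (m * b1 + n * b2) - (m * a1 + n * a2) * (k * b1 + l * b2) = f (vector [1, 0])"
     "(k * a1 + l * a2) * (m * c1 + n * c2) - (m * a1 + n * a2) * (k * c1 + l * c2) = g (vector [1, 0])"
    using N(1) B(2,3) by simp_all
  show ?thesis unfolding direct_composition_iff
  proof (intro exI conjI allI)
    fix x y z w
    show "f (vector [x, y]) * g (vector [z, w]) =
      h' (vector [(k * a1 + l * a2) * x * z + (k * b1 + l * b2) * x * w + (k * c1 + l * c2) * y * z + (k * d1 + l * d2) * y * w,
       (m * a1 + n * a2) * x * z + (m * b1 + n * b2) * x * w + (m * c1 + n * c2) * y * z + (m * d1 + n * d2) * y * w])"
      unfolding B(1) N(2) by (simp add: algebra_simps)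
  qed (use eqs in auto)
qed

text \<open>Moving representatives back to \<open>f\<close> and \<open>g\<close> one argument at a
  time and applying uniqueness puts every composition into the class of \<open>h\<close>; conversely
  each form equivalent to \<open>h\<close> is itself a direct composition of \<open>f\<close> and
  \<open>g\<close>.\<close>

lemma form_class_mult:
  assumes fo: "f \<in> forms \<Delta>" "g \<in> forms \<Delta>" "h \<in> forms \<Delta>" and ns: "\<And>k. k^2 \<noteq> \<Delta>"
    and c: "direct_composition f g h"
  shows "form_class \<Delta> f \<otimes>\<^bsub>narrow_class_group \<Delta>\<^esub> form_class \<Delta> g = form_class \<Delta> h"
proof -
  have sym: "(x, y) \<in> form_rel \<Delta> \<Longrightarrow> (y, x) \<in> form_rel \<Delta>" for x y
    using equivE[OF equiv_form_rel] by (metis symD)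
  have 1: "h' \<in> form_class \<Delta> h" if h': "h' \<in> forms \<Delta>" "(f, f') \<in> form_rel \<Delta>" "(g, g') \<in> form_rel \<Delta>" "direct_composition f' g' h'" for h' f' g'
  proof -
    have fo': "f' \<in> forms \<Delta>" "g' \<in> forms \<Delta>" using h' by (auto simp: form_rel_def)
    have "direct_composition f g' h'" using direct_composition_left[OF sym[OF h'(2)] fo'(2) h'(1) ns h'(4)] .
    hence "direct_composition g f h'"
      using direct_composition_left[OF sym[OF h'(3)] fo(1) h'(1) ns direct_composition_sym] by blast
    from direct_composition_unique[OF fo(1,2) h'(1) fo(3) ns direct_composition_sym[OF this] c]
    show ?thesis by (simp add: form_class_def)
  qed
  have 2: "h' \<in> forms \<Delta> \<and> (\<exists>f'. (f, f') \<in> form_rel \<Delta> \<and> (\<exists>g'. (g, g') \<in> form_rel \<Delta> \<and> direct_composition f' g' h'))"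
    if "h' \<in> form_class \<Delta> h" for h'
  proof -
    have "(h, h') \<in> form_rel \<Delta>" using that by (simp add: form_class_def)
    moreover have "(f, f) \<in> form_rel \<Delta>" "(g, g) \<in> form_rel \<Delta>"
      using fo form_class_eq_iff by blast+
    ultimately show ?thesis using direct_composition_result[OF _ c] form_relE by meson
  qed
  have "form_class \<Delta> f \<otimes>\<^bsub>narrow_class_group \<Delta>\<^esub> form_class \<Delta> g
      = {h' \<in> forms \<Delta>. \<exists>f'. (f, f') \<in> form_rel \<Delta> \<and> (\<exists>g'. (g, g') \<in> form_rel \<Delta> \<and> direct_composition f' g' h')}"
    by (simp add: narrow_class_group_def form_class_def Bex_def Image_singleton_iff)
  also have "\<dots> = form_class \<Delta> h" using 1 2 by blast
  finally show ?thesis .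
qed

section \<open>Cubes\<close>

lemma SL2Z_transpose: "M \<in> SL2Z \<Longrightarrow> transpose M \<in> SL2Z"
  by (simp add: SL2Z_def det_transpose)

text \<open>\<open>N\<close> and \<open>R\<close> multiply the pencil of matrices from the two sides
  and drop out of its determinant; \<open>M\<close> mixes the two matrices, hence the
  variables.\<close>

lemma Q1_cube_act:
  assumes "N \<in> SL2Z" "R \<in> SL2Z"
  shows "Q1 (cube_act (M, N, R) (A, B)) v = Q1 (A, B) (transpose M *v v)"
proof -
  define A' where "A' = R ** (\<chi> i j. M $ 1 $ 1 * A $ i $ j + M $ 1 $ 2 * B $ i $ j) ** transpose N"
  define B' where "B' = R ** (\<chi> i j. M $ 2 $ 1 * A $ i $ j + M $ 2 $ 2 * B $ i $ j) ** transpose N"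
  have "(\<chi> i j. A' $ i $ j * v $ 1 + B' $ i $ j * v $ 2) =
      R ** (\<chi> i j. A $ i $ j * (transpose M *v v) $ 1 + B $ i $ j * (transpose M *v v) $ 2) ** transpose N"
    unfolding A'_def B'_def
    by (simp add: vec_eq_iff forall_2 sum_2 matrix_matrix_mult_def matrix_vector_mult_def transpose_def algebra_simps)
  thus ?thesis using assms
    by (simp add: A'_def[symmetric] B'_def[symmetric] det_mul det_transpose SL2Z_def)
qed

lemma Q2_cube_act:
  assumes "M \<in> SL2Z" "R \<in> SL2Z"
  shows "Q2 (cube_act (M, N, R) (A, B)) v = Q2 (A, B) (transpose N *v v)"
proof -
  define A' where "A' = R ** (\<chi> i j. M $ 1 $ 1 * A $ i $ j + M $ 1 $ 2 * B $ i $ j) ** transpose N"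
  define B' where "B' = R ** (\<chi> i j. M $ 2 $ 1 * A $ i $ j + M $ 2 $ 2 * B $ i $ j) ** transpose N"
  have "transpose (vector [A' *v v, B' *v v] :: int ^ 2 ^ 2) =
      R ** transpose (vector [A *v (transpose N *v v), B *v (transpose N *v v)] :: int ^ 2 ^ 2) ** transpose M"
    unfolding A'_def B'_def
    by (simp add: vec_eq_iff forall_2 sum_2 matrix_matrix_mult_def matrix_vector_mult_def transpose_def algebra_simps)
  hence "det (transpose (vector [A' *v v, B' *v v] :: int ^ 2 ^ 2)) =
      det R * det (transpose (vector [A *v (transpose N *v v), B *v (transpose N *v v)] :: int ^ 2 ^ 2)) * det (transpose M)"
    by (simp only: det_mul)
  thus ?thesis using assms
    by (simp add: A'_def[symmetric] B'_def[symmetric] det_mul det_transpose SL2Z_def)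
qed

lemma cube_rel_refl:
  assumes "C \<in> cubes \<Delta>" shows "(C, C) \<in> cube_rel \<Delta>"
proof -
  obtain A B where C: "C = (A, B)" by fastforce
  have "cube_act (mat 1, mat 1, mat 1) C = C"
    unfolding C by (simp add: vec_eq_iff forall_2 sum_2 matrix_matrix_mult_def transpose_def mat_def)
  moreover have "(mat 1 :: int^2^2) \<in> SL2Z" by (simp add: SL2Z_def)
  ultimately show ?thesis using assms unfolding cube_rel_def by force
qed

lemma cube_rel_forms:
  assumes "(C, C') \<in> cube_rel \<Delta>"
  shows "(Q1 C, Q1 C') \<in> form_rel \<Delta>" "(Q2 C, Q2 C') \<in> form_rel \<Delta>"
proof -
  obtain A B where C: "C = (A, B)" by fastforce
  from assms obtain M N R where *: "C \<in> cubes \<Delta>" "C' \<in> cubes \<Delta>"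
    "M \<in> SL2Z" "N \<in> SL2Z" "R \<in> SL2Z" "C' = cube_act (M, N, R) C"
    unfolding cube_rel_def by auto
  have "Q1 C' = (\<lambda>v. Q1 C (transpose M *v v))" "Q2 C' = (\<lambda>v. Q2 C (transpose N *v v))"
    unfolding *(6) C using Q1_cube_act Q2_cube_act * by blast+
  thus "(Q1 C, Q1 C') \<in> form_rel \<Delta>" "(Q2 C, Q2 C') \<in> form_rel \<Delta>"
    using * SL2Z_transpose unfolding form_rel_def cubes_def by blast+
qed

lemma cube_phi_cube_class:
  assumes "C \<in> cubes \<Delta>"
  shows "cube_phi \<Delta> (cube_class \<Delta> C) = (form_class \<Delta> (Q1 C), form_class \<Delta> (Q2 C))"
proof -
  have "form_class \<Delta> (Q1 C') = form_class \<Delta> (Q1 C)" "form_class \<Delta> (Q2 C') = form_class \<Delta> (Q2 C)"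
    if "C' \<in> cube_class \<Delta> C" for C'
    using cube_rel_forms[of C C' \<Delta>] that equiv_class_eq[OF equiv_form_rel]
    unfolding cube_class_def form_class_def by auto
  moreover have "C \<in> cube_class \<Delta> C" using cube_rel_refl[OF assms] by (simp add: cube_class_def)
  ultimately show ?thesis unfolding cube_phi_def by blast
qed

text \<open>\<open>inv_into\<close> returns a preimage only for points of the image. The cube
  \<open>C''\<close> witnesses that the product pair is such a point, and applying
  \<open>cube_phi\<close> then gives the pair back.\<close>

lemma cube_class_group_mult:
  assumes "C \<in> cubes \<Delta>" "C' \<in> cubes \<Delta>" "C'' \<in> cubes \<Delta>"
    and "form_class \<Delta> (Q1 C) \<otimes>\<^bsub>narrow_class_group \<Delta>\<^esub> form_class \<Delta> (Q1 C') = form_class \<Delta> (Q1 C'')"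
    and "form_class \<Delta> (Q2 C) \<otimes>\<^bsub>narrow_class_group \<Delta>\<^esub> form_class \<Delta> (Q2 C') = form_class \<Delta> (Q2 C'')"
  shows "cube_class \<Delta> C \<otimes>\<^bsub>cube_class_group \<Delta>\<^esub> cube_class \<Delta> C' \<in> carrier (cube_class_group \<Delta>)"
    and "cube_phi \<Delta> (cube_class \<Delta> C \<otimes>\<^bsub>cube_class_group \<Delta>\<^esub> cube_class \<Delta> C')
         = (form_class \<Delta> (Q1 C''), form_class \<Delta> (Q2 C''))"
proof -
  let ?y = "(form_class \<Delta> (Q1 C''), form_class \<Delta> (Q2 C''))"
  have T: "cube_class \<Delta> C \<otimes>\<^bsub>cube_class_group \<Delta>\<^esub> cube_class \<Delta> C'
      = inv_into (cubes \<Delta> // cube_rel \<Delta>) (cube_phi \<Delta>) ?y"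
    using assms by (simp add: cube_class_group_def Let_def cube_phi_cube_class mult_DirProd)
  have "cube_class \<Delta> C'' \<in> cubes \<Delta> // cube_rel \<Delta>"
    using assms(3) by (simp add: cube_class_def quotientI)
  hence "?y \<in> cube_phi \<Delta> ` (cubes \<Delta> // cube_rel \<Delta>)"
    using cube_phi_cube_class[OF assms(3)] by (metis image_eqI)
  from inv_into_into[OF this] f_inv_into_f[OF this]
  show "cube_class \<Delta> C \<otimes>\<^bsub>cube_class_group \<Delta>\<^esub> cube_class \<Delta> C' \<in> carrier (cube_class_group \<Delta>)"
    "cube_phi \<Delta> (cube_class \<Delta> C \<otimes>\<^bsub>cube_class_group \<Delta>\<^esub> cube_class \<Delta> C') = ?y"
    unfolding T by (simp_all add: cube_class_group_def Let_def)
qed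

section \<open>Discriminants without square factors and primitivity of forms\<close>

text \<open>For \<open>D \<equiv> 0, 1 (mod 4)\<close> this characterizes the fundamental discriminants.\<close>

definition minimal_disc :: "int \<Rightarrow> bool" where
  "minimal_disc D \<longleftrightarrow> (\<forall>n E. D = n^2 * E \<longrightarrow> E mod 4 \<in> {0, 1} \<longrightarrow> n^2 = 1)"

lemma minimal_discD:
  assumes "minimal_disc D" "D = n^2 * E" "E mod 4 \<in> {0, 1}" shows "n^2 = 1"
  using assms(1)[unfolded minimal_disc_def, rule_format, OF assms(2,3)] .

text \<open>A square factor n^2 of -3 D is prime to 3, since 9 would force 3 into D; so it already
  divides D. The cofactor E = 3 E' becomes -E', which is congruent to E modulo 4 because 3 is -1
  there.\<close>

lemma minimal_disc_times_3:
  assumes "minimal_disc D" "\<not> 3 dvd D"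
  shows "minimal_disc (- 3 * D)"
  unfolding minimal_disc_def
proof (intro allI impI)
  fix n E :: int assume *: "- 3 * D = n^2 * E" "E mod 4 \<in> {0, 1}"
  have n: "\<not> 3 dvd n"
  proof
    assume "3 dvd n" then obtain k where "n = 3 * k" by blast
    hence "D = 3 * (- (k^2) * E)" using * by (auto simp: power2_eq_square algebra_simps)
    thus False using assms(2) by (metis dvd_triv_left)
  qed
  have "3 dvd n^2 * E" by (metis *(1) dvd_mult2 dvd_minus_iff dvd_refl)
  moreover have "prime (3::int)" by simp
  ultimately have "3 dvd E" using n prime_dvd_mult_iff prime_dvd_power by blast
  then obtain E' where E': "E = 3 * E'" by blast
  have "D = n^2 * (- E')" using * E' by (auto simp: algebra_simps)
  moreover have "(- E') mod 4 \<in> {0, 1}" using *(2) unfolding E' insert_iff empty_iff by presburger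
  ultimately show "n^2 = 1" using assms(1) minimal_discD by metis
qed

lemma square_mod_4: "(k::int)^2 mod 4 \<in> {0, 1}"
proof (cases "even k")
  case True
  then obtain l where "k = 2 * l" by blast
  thus ?thesis by (simp add: power2_eq_square)
next
  case False
  then obtain l where "k = 2 * l + 1" by (elim oddE)
  hence "k^2 = 1 + 4 * (l * l + l)" by (simp add: power2_eq_square algebra_simps)
  thus ?thesis by (simp only: mod_mult_self2) simp
qed

text \<open>A common divisor n of the coefficients leaves a form of discriminant \<Delta> / n^2,
  again 0 or 1 modulo 4, so minimality forces n = 1. Membership in \<open>forms\<close> is thereby
  reduced to a discriminant and a sign.\<close>

lemma minimal_disc_forms:
  assumes "minimal_disc \<Delta>" "q^2 - 4 * p * r = \<Delta>" "\<Delta> < 0 \<Longrightarrow> p > 0"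
  shows "bqf_of p q r \<in> forms \<Delta>"
proof -
  define n where "n = Gcd {p, q, r}"
  have "n dvd p" "n dvd q" "n dvd r" unfolding n_def by (rule Gcd_dvd, simp)+
  then obtain p' q' r' where *: "p = n * p'" "q = n * q'" "r = n * r'" by (elim dvdE)
  have "\<Delta> = n^2 * (q'^2 - 4 * p' * r')" using assms(2) unfolding * by (simp add: algebra_simps power2_eq_square)
  moreover have "(q'^2 - 4 * p' * r') mod 4 \<in> {0, 1}"
  proof -
    have "(q'^2 - 4 * p' * r') mod 4 = q'^2 mod 4"
      by (metis (no_types, opaque_lifting) mod_mult_self2 mult.assoc diff_add_cancel)
    thus ?thesis using square_mod_4 by simp
  qed
  ultimately have "n^2 = 1" using assms(1) minimal_discD by metis
  moreover have "n \<ge> 0" unfolding n_def by simp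
  ultimately have "n = 1" by (simp add: power2_eq_1_iff)
  thus ?thesis unfolding forms_def n_def using assms by blast
qed

text \<open>The prime 3 divides -3 D exactly once.\<close>

lemma times_3_nonsquare:
  fixes D k :: int
  assumes "\<not> 3 dvd D" shows "k^2 \<noteq> - 3 * D"
proof
  assume *: "k^2 = - 3 * D"
  hence "3 dvd k^2" by simp
  moreover have "prime (3::int)" by simp
  ultimately have "3 dvd k" using prime_dvd_power by blast
  then obtain l where "k = 3 * l" by blast
  hence "D = 3 * (- (l^2))" using * by (simp add: power2_eq_square)
  thus False using assms by (metis dvd_triv_left)
qed

section \<open>The Hessian, the two cubes, and composition with the class above 3\<close>

text \<open>Normalized as -1/4 times the determinant of the second derivatives of the cubic
  form.\<close>

definition hessian :: "int \<Rightarrow> int \<Rightarrow> int \<Rightarrow> int \<Rightarrow> bqf" where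
  "hessian a b c d = bqf_of (b^2 - 3 * a * c) (b * c - 9 * a * d) (c^2 - 3 * b * d)"

lemma hessian_disc:
  "(b * c - 9 * a * d)^2 - 4 * (b^2 - 3 * a * c) * (c^2 - 3 * b * d) = - 3 * cubic_disc a b c d"
  unfolding cubic_disc_def by (simp add: algebra_simps power2_eq_square power3_eq_cube)

lemma hessian_pos:
  assumes "cubic_disc a b c d > 0" shows "b^2 - 3 * a * c > 0"
proof (rule ccontr)
  assume "\<not> ?thesis"
  hence le: "b^2 - 3 * a * c \<le> 0" by simp
  \<comment> \<open>The syzygy 4 H^3 = G^2 + 27 D F^2 between the covariants of a binary cubic,
    evaluated at (1, 0).\<close>
  have "4 * (b^2 - 3 * a * c)^3 = (2 * b^3 - 9 * a * b * c + 27 * a^2 * d)^2 + 27 * a^2 * cubic_disc a b c d"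
    unfolding cubic_disc_def by (simp add: algebra_simps power2_eq_square power3_eq_cube)
  moreover have "(b^2 - 3 * a * c)^3 \<le> 0" using le by (simp add: power_le_zero_eq)
  moreover have "27 * a^2 * cubic_disc a b c d \<ge> 0" using assms by simp
  ultimately have "27 * a^2 * cubic_disc a b c d = 0"
    using zero_le_power2[of "2 * b^3 - 9 * a * b * c + 27 * a^2 * d"] by linarith
  hence "a = 0" using assms by simp
  moreover hence "b = 0" using le by simp
  ultimately show False using assms unfolding cubic_disc_def by simp
qed

lemma hessian_in_forms:
  assumes "minimal_disc (- 3 * cubic_disc a b c d)"
  shows "hessian a b c d \<in> forms (- 3 * cubic_disc a b c d)"
  unfolding hessian_def using minimal_disc_forms[OF assms hessian_disc] hessian_pos by simp

lemma bqf_eqI: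
  assumes "\<And>x y. f (vector [x, y]) = g (vector [x, y])"
  shows "f = (g :: bqf)"
proof
  fix v show "f v = g v" using assms[of "v$1" "v$2"] vec2_eq[of v] by simp
qed

lemma Q_vector:
  fixes A B :: "int^2^2"
  shows
  "Q1 (A, B) (vector [x, y]) = - ((A$1$1 * x + B$1$1 * y) * (A$2$2 * x + B$2$2 * y)
      - (A$1$2 * x + B$1$2 * y) * (A$2$1 * x + B$2$1 * y))"
  "Q2 (A, B) (vector [x, y]) = - ((A$1$1 * x + A$1$2 * y) * (B$2$1 * x + B$2$2 * y)
      - (B$1$1 * x + B$1$2 * y) * (A$2$1 * x + A$2$2 * y))"
  "Q3 (A, B) (vector [x, y]) = - ((A$1$1 * x + A$2$1 * y) * (B$1$2 * x + B$2$2 * y)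
      - (B$1$1 * x + B$2$1 * y) * (A$1$2 * x + A$2$2 * y))"
  by (simp_all add: det_2 transpose_def matrix_vector_mult_def sum_2 algebra_simps)

lemma form_cube_forms:
  "Q1 (form_cube a b c d) = hessian a b c d"
  "Q2 (form_cube a b c d) = hessian a b c d"
  "Q3 (form_cube a b c d) = hessian a b c d"
  by (rule bqf_eqI, simp add: form_cube_def Q_vector hessian_def algebra_simps power2_eq_square del: Q1.simps Q2.simps Q3.simps)+

text \<open>For \<open>3 dvd b\<close>, the symmetric cube \<open>\<K>\<^sub>F\<close> is moved by the substitution \<open>(x, 3 y)\<close> in its last two
  directions and divided by 3; the directions are then permuted cyclically.\<close>

lemma twisted_form_cube:
  fixes a b c d :: int
  defines "C \<equiv> (vector [vector [a, 3 * b], vector [b, c]], vector [vector [3 * b, 3 * c], vector [c, 9 * d]])"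
  shows "Q1 C = bqf_of (3 * b^2 - a * c) (3 * (b * c - 3 * a * d)) (3 * (c^2 - 9 * b * d))"
    "Q2 C = bqf_of (3 * b^2 - a * c) (3 * (b * c - 3 * a * d)) (3 * (c^2 - 9 * b * d))"
    "Q3 C = hessian a (3 * b) c d"
  unfolding C_def
  by (rule bqf_eqI, simp add: Q_vector hessian_def algebra_simps power2_eq_square del: Q1.simps Q2.simps Q3.simps)+

lemma hessian_3:
  "hessian a (3 * b) c d = bqf_of (3 * (3 * b^2 - a * c)) (3 * (b * c - 3 * a * d)) (c^2 - 9 * b * d)"
  by (rule bqf_eqI, simp add: hessian_def algebra_simps power2_eq_square)

text \<open>Equal discriminants make s - e even, and replacing x by x + t y changes the middle
  coefficient of (3, 3 e, m) by 6 t. In particular (3, 3 e, m) is equivalent to its own inverse (3,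
  -3 e, m).\<close>

lemma same_disc_translate:
  fixes e s m m' :: int
  assumes "(3 * e)^2 - 4 * 3 * m = (3 * s)^2 - 4 * 3 * m'"
    "bqf_of 3 (3 * e) m \<in> forms \<Delta>" "bqf_of 3 (3 * s) m' \<in> forms \<Delta>"
  shows "(bqf_of 3 (3 * e) m, bqf_of 3 (3 * s) m') \<in> form_rel \<Delta>"
proof -
  have 1: "3 * (s * s - e * e) = 4 * (m' - m)" using assms(1) by (simp add: power2_eq_square)
  hence "even (3 * (s * s - e * e))" by simp
  hence "even (s - e)" by simp
  then obtain t where "s - e = 2 * t" by blast
  hence t: "s = e + 2 * t" by simp
  have m': "m' = m + 3 * e * t + 3 * t * t" using 1 unfolding t by (simp add: algebra_simps)
  show ?thesis
    by (rule form_relI[OF assms(2,3), where k = 1 and l = t and m = 0 and n = 1])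
      (simp_all add: t m' algebra_simps power2_eq_square)
qed

lemma compose_with_3:
  fixes p s r e m \<Delta> :: int
  assumes ns: "\<And>k. k^2 \<noteq> \<Delta>"
    and fo: "bqf_of (3 * p) (3 * s) r \<in> forms \<Delta>" "bqf_of 3 (3 * e) m \<in> forms \<Delta>"
      "bqf_of 3 (3 * s) (p * r) \<in> forms \<Delta>" "bqf_of p (3 * s) (3 * r) \<in> forms \<Delta>"
    and disc: "(3 * s)^2 - 12 * p * r = \<Delta>" "(3 * e)^2 - 12 * m = \<Delta>"
  shows "form_class \<Delta> (bqf_of (3 * p) (3 * s) r) \<otimes>\<^bsub>narrow_class_group \<Delta>\<^esub> form_class \<Delta> (bqf_of 3 (3 * e) m)
      = form_class \<Delta> (bqf_of p (3 * s) (3 * r))"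
proof -
  have "(bqf_of 3 (3 * e) m, bqf_of 3 (3 * s) (p * r)) \<in> form_rel \<Delta>"
    by (rule same_disc_translate) (use disc fo in auto)
  hence eq: "form_class \<Delta> (bqf_of 3 (3 * e) m) = form_class \<Delta> (bqf_of 3 (3 * s) (p * r))"
    using form_class_eq_iff fo by blast
  \<comment> \<open>The factor 3 common to 3 p, 3 and 3 s cancels, so the product has leading
    coefficient 9 p / 3^2. The eight numbers are chosen to have the minors that both factors
    prescribe: 3 s for the columns a, d and 0 for b, c.\<close>
  have "direct_composition (bqf_of (3 * p) (3 * s) r) (bqf_of 3 (3 * s) (p * r)) (bqf_of p (3 * s) (3 * r))"
    unfolding direct_composition_iff
    by (rule exI[of _ 3], rule exI[of _ 0], rule exI[of _ 0], rule exI[of _ "-r"],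
      rule exI[of _ 0], rule exI[of _ p], rule exI[of _ 1], rule exI[of _ s])
      (simp add: algebra_simps power2_eq_square)
  thus ?thesis unfolding eq using form_class_mult fo ns by blast
qed

text \<open>Stickelberger's congruence in explicit form; it serves both the case split in
  \<open>disc_cube\<close> and the appeal to minimality at the prime 3.\<close>

lemma cong_cubic_disc_4: "[cubic_disc a b c d = (b * c + a * d)^2] (mod 4)"
proof -
  have "cubic_disc a b c d = (b * c + a * d)^2 + 4 * (- a * c^3 - b^3 * d - 7 * a^2 * d^2 + 4 * a * b * c * d)"
    unfolding cubic_disc_def by (simp add: algebra_simps power2_eq_square)
  thus ?thesis unfolding cong_def by (simp only: mod_mult_self2)
qed

lemma disc_cube_forms:
  assumes "minimal_disc (- 3 * D)" "D mod 4 \<in> {0, 1}"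
  obtains e m where "(3 * e)^2 - 12 * m = - 3 * D" "disc_cube D \<in> cubes (- 3 * D)"
    "Q1 (disc_cube D) = bqf_of 3 (3 * e) m" "Q2 (disc_cube D) = bqf_of m (3 * e) 3" "D > 0 \<Longrightarrow> m > 0"
proof -
  \<comment> \<open>\<open>e\<close> merges the two cases of \<open>disc_cube\<close>: with 4 m = D
    + 3 e and e^2 = e, the form (3, 3 e, m) has discriminant 9 e - 3 (D + 3 e) = -3 D.\<close>
  define e m :: int where "e = (if D mod 4 = 1 then 1 else 0)"
    and "m = (if D mod 4 = 1 then (D + 3) div 4 else D div 4)"
  have em: "4 * m = D + 3 * e" using assms(2) unfolding e_def m_def insert_iff empty_iff
    by (auto; presburger)
  have ee: "e * e = e" by (simp add: e_def)
  have C: "disc_cube D = (vector [vector [0, 3], vector [1, 0]], vector [vector [m, 3 * e], vector [0, -1]])"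
    using assms(2) by (auto simp: disc_cube_def cong_def e_def m_def)
  \<comment> \<open>The third form represents 1 and so is principal, in line with the first two
    being inverse to each other.\<close>
  have Q: "Q1 (disc_cube D) = bqf_of 3 (3 * e) m" "Q2 (disc_cube D) = bqf_of m (3 * e) 3"
    "Q3 (disc_cube D) = bqf_of (3 * m) (- 3 * e) 1"
    unfolding C by (rule bqf_eqI, simp add: Q_vector algebra_simps power2_eq_square del: Q1.simps Q2.simps Q3.simps)+
  have di: "(3 * e)^2 - 12 * m = - 3 * D" using em ee by (auto simp: power2_eq_square)
  have pos: "m > 0" if "D > 0" using that em unfolding e_def by (auto split: if_splits)
  have "disc_cube D \<in> cubes (- 3 * D)"
    unfolding cubes_def mem_Collect_eq Q
    by (intro conjI; rule minimal_disc_forms[OF assms(1)])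
      (use di pos in \<open>simp_all add: algebra_simps power2_eq_square\<close>)
  thus thesis using that di Q pos by blast
qed

lemma twist_class:
  fixes a b c d :: int
  defines "D \<equiv> cubic_disc a (3 * b) c d"
  defines "h \<equiv> bqf_of (3 * b^2 - a * c) (3 * (b * c - 3 * a * d)) (3 * (c^2 - 9 * b * d))"
  assumes min: "minimal_disc (- 3 * D)" and three: "\<not> 3 dvd D"
  shows "h \<in> forms (- 3 * D)"
    and "form_class (- 3 * D) (hessian a (3 * b) c d) \<otimes>\<^bsub>narrow_class_group (- 3 * D)\<^esub>
        form_class (- 3 * D) (Q1 (disc_cube D)) = form_class (- 3 * D) h"
    and "form_class (- 3 * D) (hessian a (3 * b) c d) \<otimes>\<^bsub>narrow_class_group (- 3 * D)\<^esub>
        form_class (- 3 * D) (Q2 (disc_cube D)) = form_class (- 3 * D) h"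
    and "\<exists>C \<in> cubes (- 3 * D). Q1 C = h \<and> Q2 C = h"
    and "disc_cube D \<in> cubes (- 3 * D)"
proof -
  define p s r where psr: "p = 3 * b^2 - a * c" "s = b * c - 3 * a * d" "r = c^2 - 9 * b * d"
  have ns: "\<And>k. k^2 \<noteq> - 3 * D" using times_3_nonsquare[OF three] .
  have mod4: "D mod 4 \<in> {0, 1}"
    using cong_cubic_disc_4[of a "3 * b" c d] square_mod_4 unfolding D_def cong_def by metis
  obtain e m where em: "(3 * e)^2 - 12 * m = - 3 * D" and dc: "disc_cube D \<in> cubes (- 3 * D)"
    and Q: "Q1 (disc_cube D) = bqf_of 3 (3 * e) m" "Q2 (disc_cube D) = bqf_of m (3 * e) 3"
    and m: "D > 0 \<Longrightarrow> m > 0"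
    using disc_cube_forms[OF min mod4] by metis
  have H: "hessian a (3 * b) c d = bqf_of (3 * p) (3 * s) r" unfolding psr by (rule hessian_3)
  have h: "h = bqf_of p (3 * s) (3 * r)" unfolding h_def psr ..
  have di: "(3 * s)^2 - 12 * p * r = - 3 * D"
    using hessian_disc[of "3 * b" c a d] unfolding psr D_def by (simp add: algebra_simps power2_eq_square)
  have pos: "p > 0" if "D > 0"
    using hessian_pos[of a "3 * b" c d] that unfolding psr D_def by (simp add: power2_eq_square)
  have fo: "bqf_of (3 * p) (3 * s) r \<in> forms (- 3 * D)" "bqf_of p (3 * s) (3 * r) \<in> forms (- 3 * D)"
    "bqf_of 3 (3 * s) (p * r) \<in> forms (- 3 * D)" "bqf_of 3 (3 * e) m \<in> forms (- 3 * D)"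
    "bqf_of m (3 * e) 3 \<in> forms (- 3 * D)" "bqf_of 3 (3 * (- e)) m \<in> forms (- 3 * D)"
    by (rule minimal_disc_forms[OF min];
        use di em pos m in \<open>simp add: algebra_simps power2_eq_square\<close>)+
  show "h \<in> forms (- 3 * D)" unfolding h by (rule fo)
  show "form_class (- 3 * D) (hessian a (3 * b) c d) \<otimes>\<^bsub>narrow_class_group (- 3 * D)\<^esub>
        form_class (- 3 * D) (Q1 (disc_cube D)) = form_class (- 3 * D) h"
    unfolding H Q h by (rule compose_with_3[OF ns fo(1,4,3,2) di em])
  \<comment> \<open>A quarter turn brings the second form of the cube to the shape required by
    \<open>compose_with_3\<close>, with -e in place of e.\<close>
  have "(bqf_of m (3 * e) 3, bqf_of 3 (3 * (- e)) m) \<in> form_rel (- 3 * D)"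
    by (rule form_relI[OF fo(5,6), where k = 0 and l = "-1" and m = 1 and n = 0])
      (simp_all add: algebra_simps)
  hence "form_class (- 3 * D) (bqf_of m (3 * e) 3) = form_class (- 3 * D) (bqf_of 3 (3 * (- e)) m)"
    using form_class_eq_iff fo by blast
  moreover have "(3 * (- e))^2 - 12 * m = - 3 * D" using em by simp
  ultimately show "form_class (- 3 * D) (hessian a (3 * b) c d) \<otimes>\<^bsub>narrow_class_group (- 3 * D)\<^esub>
        form_class (- 3 * D) (Q2 (disc_cube D)) = form_class (- 3 * D) h"
    unfolding H Q h using compose_with_3[OF ns fo(1,6,3,2) di] by simp
  show "disc_cube D \<in> cubes (- 3 * D)" by fact
  \<comment> \<open>The third form of the twisted cube is the Hessian, so its membership is what
    remains for the cube to lie in \<open>cubes\<close>.\<close>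
  have "hessian a (3 * b) c d \<in> forms (- 3 * D)" unfolding H by (rule fo)
  thus "\<exists>C \<in> cubes (- 3 * D). Q1 C = h \<and> Q2 C = h"
    using twisted_form_cube[of a b c d] \<open>h \<in> forms _\<close> unfolding cubes_def h_def[symmetric]
    by (metis (mono_tags, lifting) mem_Collect_eq)
qed

text \<open>\<open>(a', 3 b', c', d')\<close> is the form \<open>(a, b, c, d)\<close> after a substitution that moves a root modulo 3 of
  the Hessian to \<open>(1 : 0)\<close>.\<close>

lemma cube_class_product:
  fixes a b c d a' b' c' d' :: int
  defines "D \<equiv> cubic_disc a b c d"
  defines "T \<equiv> cube_class (- 3 * D) (form_cube a b c d)
       \<otimes>\<^bsub>cube_class_group (- 3 * D)\<^esub> cube_class (- 3 * D) (disc_cube D)"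
  assumes min: "minimal_disc (- 3 * D)" and three: "\<not> 3 dvd D"
    and D': "cubic_disc a' (3 * b') c' d' = D"
    and rel: "(hessian a b c d, hessian a' (3 * b') c' d') \<in> form_rel (- 3 * D)"
  shows "T \<in> carrier (cube_class_group (- 3 * D))"
    and "fst (cube_phi (- 3 * D) T) = form_class (- 3 * D)
       (bqf_of (3 * b'^2 - a' * c') (3 * (b' * c' - 3 * a' * d')) (3 * (c'^2 - 9 * b' * d')))"
proof -
  note tw = twist_class[of a' b' c' d', unfolded D', OF min three]
  obtain C where C: "C \<in> cubes (- 3 * D)"
    "Q1 C = bqf_of (3 * b'^2 - a' * c') (3 * (b' * c' - 3 * a' * d')) (3 * (c'^2 - 9 * b' * d'))"
    "Q2 C = bqf_of (3 * b'^2 - a' * c') (3 * (b' * c' - 3 * a' * d')) (3 * (c'^2 - 9 * b' * d'))"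
    using tw(4) by blast
  have H: "form_class (- 3 * D) (hessian a b c d) = form_class (- 3 * D) (hessian a' (3 * b') c' d')"
    using rel form_class_eq_iff form_relE by metis
  have "form_cube a b c d \<in> cubes (- 3 * D)"
    using rel by (auto simp: cubes_def form_cube_forms elim: form_relE)
  from cube_class_group_mult[OF this tw(5) C(1)] tw(2,3)
  show "T \<in> carrier (cube_class_group (- 3 * D))"
    "fst (cube_phi (- 3 * D) T) = form_class (- 3 * D)
       (bqf_of (3 * b'^2 - a' * c') (3 * (b' * c' - 3 * a' * d')) (3 * (c'^2 - 9 * b' * d')))"
    unfolding T_def form_cube_forms H C(2,3) by auto
qed

section \<open>Traces and quadratic fields\<close>

text \<open>\<open>field_trace\<close> uses a basis picked by \<open>SOME\<close>, so this is the
  basis independence of the trace. With S the coordinates in C of x times the elements of B, and T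
  the coordinates in B of the elements of C, the interchange of sums is tr(S T) = tr(T S).\<close>

lemma field_trace_eq:
  fixes e :: "'n::finite \<Rightarrow> 'a::field_char_0" and m :: "'n \<Rightarrow> 'n \<Rightarrow> rat"
  assumes basis: "field_basis K (range e)" and inj: "inj e"
    and x: "\<And>i. x * e i = (\<Sum>j\<in>UNIV. of_rat (m i j) * e j)"
  shows "field_trace K x = (\<Sum>i\<in>UNIV. m i i)"
proof -
  define C where "C = range e"
  define B where "B = (SOME B. field_basis K B)"
  have C: "rat_vs.independent C" "rat_vs.span C = K" "finite C"
    using basis by (auto simp: field_basis_def C_def)
  have "field_basis K B" unfolding B_def using someI[of "field_basis K"] basis by blast
  hence B: "rat_vs.independent B" "rat_vs.span B = K" by (auto simp: field_basis_def)
  have Bfin: "finite B"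
    using rat_vs.independent_span_bound[OF C(3) B(1)] B(2) C(2) rat_vs.span_superset by metis
  have repC: "rat_vs.representation C (x * e i) (e j) = m i j" for i j
  proof -
    have "rat_vs.representation C (x * e i) = (\<lambda>c. if c \<in> C then m i (the_inv e c) else 0)"
    proof (rule rat_vs.representation_eqI[OF C(1)])
      have "x * e i = (\<Sum>j\<in>UNIV. rat_scale (m i j) (e j))" by (simp add: x rat_scale_def)
      moreover have "\<dots> \<in> rat_vs.span C"
        by (intro rat_vs.span_sum rat_vs.span_scale rat_vs.span_base) (simp add: C_def)
      ultimately show "x * e i \<in> rat_vs.span C" by simp
      show "finite {c. (if c \<in> C then m i (the_inv e c) else 0) \<noteq> 0}"
        by (rule finite_subset[OF _ C(3)]) (auto split: if_splits)
      have "(\<Sum>c | (if c \<in> C then m i (the_inv e c) else 0) \<noteq> 0. rat_scale (if c \<in> C then m i (the_inv e c) else 0) c)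
          = (\<Sum>c\<in>C. rat_scale (m i (the_inv e c)) c)"
        by (rule sum.mono_neutral_cong_left) (use C(3) in \<open>auto simp: rat_scale_def split: if_splits\<close>)
      also have "\<dots> = (\<Sum>j\<in>UNIV. rat_scale (m i j) (e j))"
        unfolding C_def using inj by (simp add: sum.reindex the_inv_f_f)
      finally show "(\<Sum>c | (if c \<in> C then m i (the_inv e c) else 0) \<noteq> 0. rat_scale (if c \<in> C then m i (the_inv e c) else 0) c) = x * e i"
        by (simp add: x rat_scale_def)
    qed (auto split: if_splits)
    thus ?thesis using inj by (simp add: C_def the_inv_f_f)
  qed
  have xK: "x * y \<in> K" if "y \<in> K" for y
  proof -
    have "y \<in> rat_vs.span C" using that C by simp
    thus ?thesis
    proof (induction rule: rat_vs.span_induct_alt)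
      case base
      show ?case using C(2) rat_vs.span_zero by (metis mult_zero_right)
    next
      case (step q c y)
      then obtain i where "c = e i" by (auto simp: C_def)
      hence "x * c = (\<Sum>j\<in>UNIV. rat_scale (m i j) (e j))" by (simp add: x rat_scale_def)
      also have "\<dots> \<in> rat_vs.span C"
        by (intro rat_vs.span_sum rat_vs.span_scale rat_vs.span_base) (simp add: C_def)
      finally have "rat_scale q (x * c) + x * y \<in> rat_vs.span C"
        using step C(2) by (intro rat_vs.span_add rat_vs.span_scale) auto
      thus ?case using C(2) by (simp add: rat_scale_def algebra_simps)
    qed
  qed
  have BK: "b \<in> K" if "b \<in> B" for b using that B(2) rat_vs.span_base by metis
  have CK: "c \<in> K" if "c \<in> C" for c using that C(2) rat_vs.span_base by metis
  have rB: "rat_vs.representation B (x * b) b' = (\<Sum>c\<in>C. rat_vs.representation C (x * b) c * rat_vs.representation B c b')"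
    if "b \<in> B" for b b'
  proof -
    have "x * b = (\<Sum>c\<in>C. rat_scale (rat_vs.representation C (x * b) c) c)"
      using rat_vs.sum_representation_eq[OF C(1) _ C(3) subset_refl, of "x * b"] xK[OF BK[OF that]] C(2) by simp
    hence "rat_vs.representation B (x * b) = rat_vs.representation B (\<Sum>c\<in>C. rat_scale (rat_vs.representation C (x * b) c) c)"
      by simp
    also have "\<dots> = (\<lambda>b'. \<Sum>c\<in>C. rat_vs.representation B (rat_scale (rat_vs.representation C (x * b) c) c) b')"
      by (rule rat_vs.representation_sum[OF B(1)]) (use CK B(2) rat_vs.span_scale in blast)
    finally show ?thesis
      using rat_vs.representation_scale[OF B(1)] CK B(2) by simp
  qed
  have "field_trace K x = (\<Sum>b\<in>B. rat_vs.representation B (x * b) b)"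
    by (simp add: field_trace_def B_def Let_def)
  also have "\<dots> = (\<Sum>b\<in>B. \<Sum>c\<in>C. rat_vs.representation C (x * b) c * rat_vs.representation B c b)"
    by (intro sum.cong refl rB)
  also have "\<dots> = (\<Sum>c\<in>C. \<Sum>b\<in>B. rat_vs.representation B c b * rat_vs.representation C (x * b) c)"
    by (subst sum.swap) (simp add: mult.commute)
  also have "\<dots> = (\<Sum>c\<in>C. rat_vs.representation C (x * c) c)"
  proof (rule sum.cong[OF refl])
    fix c assume c: "c \<in> C"
    have "c = (\<Sum>b\<in>B. rat_scale (rat_vs.representation B c b) b)"
      using rat_vs.sum_representation_eq[OF B(1) _ Bfin subset_refl, of c] CK[OF c] B(2) by simp
    hence "x * c = x * (\<Sum>b\<in>B. rat_scale (rat_vs.representation B c b) b)" by simp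
    also have "\<dots> = (\<Sum>b\<in>B. rat_scale (rat_vs.representation B c b) (x * b))"
      by (simp add: sum_distrib_left rat_scale_def algebra_simps)
    finally have "rat_vs.representation C (x * c) = rat_vs.representation C (\<Sum>b\<in>B. rat_scale (rat_vs.representation B c b) (x * b))"
      by simp
    also have "\<dots> = (\<lambda>c'. \<Sum>b\<in>B. rat_vs.representation C (rat_scale (rat_vs.representation B c b) (x * b)) c')"
      by (rule rat_vs.representation_sum[OF C(1)]) (use xK BK C(2) rat_vs.span_scale in blast)
    finally show "(\<Sum>b\<in>B. rat_vs.representation B c b * rat_vs.representation C (x * b) c) = rat_vs.representation C (x * c) c"
      using rat_vs.representation_scale[OF C(1)] xK BK C(2) by simp
  qed
  also have "\<dots> = (\<Sum>i\<in>UNIV. m i i)"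
    unfolding C_def using inj repC[unfolded C_def] by (simp add: sum.reindex)
  finally show ?thesis .
qed

lemma is_subfield_closed:
  assumes "is_subfield K"
  shows "0 \<in> K" "1 \<in> K" "x \<in> K \<Longrightarrow> y \<in> K \<Longrightarrow> x + y \<in> K" "x \<in> K \<Longrightarrow> y \<in> K \<Longrightarrow> x - y \<in> K"
    "x \<in> K \<Longrightarrow> y \<in> K \<Longrightarrow> x * y \<in> K" "of_rat q \<in> K"
proof -
  note * = assms[unfolded is_subfield_def]
  show one: "1 \<in> K" using * by blast
  show diff: "x - y \<in> K" if "x \<in> K" "y \<in> K" for x y using * that by blast
  have div: "x / y \<in> K" if "x \<in> K" "y \<in> K" for x y using * that by blast
  show zero: "0 \<in> K" using diff[OF one one] by simp
  show add: "x + y \<in> K" if "x \<in> K" "y \<in> K" for x y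
    using diff[OF that(1) diff[OF zero that(2)]] by simp
  \<comment> \<open>For y = 0 both divisions by zero return 0, which agrees with x * 0.\<close>
  show mult: "x * y \<in> K" if "x \<in> K" "y \<in> K" for x y
    using div[OF that(1) div[OF one that(2)]] by simp
  have nat: "of_nat n \<in> K" for n by (induction n) (use zero one add in auto)
  have int: "of_int n \<in> K" for n
  proof (cases n)
    case (nonneg k) thus ?thesis using nat by simp
  next
    case (neg k) 
    have "of_int n = 0 - (of_nat (Suc k) :: 'a)" using neg by simp
    thus ?thesis using diff[OF zero nat] by metis
  qed
  show "of_rat q \<in> K"
  proof -
    obtain k l where "quotient_of q = (k, l)" by fastforce
    hence "q = of_int k / of_int l" by (rule quotient_of_div)
    thus ?thesis using div[OF int int] by (simp add: of_rat_divide)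
  qed
qed

lemma common_denominator:
  fixes q :: "'n::finite \<Rightarrow> rat"
  obtains N z where "N \<noteq> (0::int)" "\<And>i. of_int N * q i = of_int (z i)"
proof -
  define den where "den i = snd (quotient_of (q i))" for i
  define N where "N = prod den UNIV"
  have den: "den i > 0" for i unfolding den_def by (rule quotient_of_denom_pos')
  hence "N \<noteq> 0" unfolding N_def by (simp add: less_imp_neq[symmetric])
  moreover have "\<exists>z. of_int N * q i = of_int z" for i
  proof -
    obtain k where k: "q i = of_int k / of_int (den i)"
      unfolding den_def by (metis quotient_of_div prod.collapse)
    moreover have "N = den i * prod den (UNIV - {i})" unfolding N_def by (simp add: prod.remove)
    ultimately have "of_int N * q i = of_int (prod den (UNIV - {i}) * k)"
      using den[of i] by (simp add: field_simps)
    thus ?thesis by blast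
  qed
  ultimately show thesis using that by metis
qed

lemma int_basis_mem: "int_basis w M \<Longrightarrow> (\<Sum>i\<in>UNIV. of_int (c $ i) * w $ i) \<in> M"
  unfolding int_basis_def bij_betw_def by blast

text \<open>Clearing denominators turns a rational relation into an integral one, which uniqueness
  of integral coordinates forbids.\<close>

lemma int_basis_rat_independent:
  fixes w :: "'a::field_char_0 ^ 'n"
  assumes w: "int_basis w M" and 0: "(\<Sum>i\<in>UNIV. of_rat (q i) * w $ i) = 0"
  shows "q i = 0"
proof -
  obtain N z where N: "N \<noteq> 0" "\<And>i. of_int N * q i = of_int (z i)" using common_denominator[of q] by metis
  have "(\<Sum>i\<in>UNIV. of_int (z i) * w $ i) = (\<Sum>i\<in>UNIV. of_rat (of_int N * q i) * w $ i)"
    unfolding N(2) by simp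
  also have "\<dots> = of_int N * (\<Sum>i\<in>UNIV. of_rat (q i) * w $ i)"
    by (simp add: sum_distrib_left of_rat_mult mult.assoc)
  finally have "(\<Sum>i\<in>UNIV. of_int ((\<chi> i. z i) $ i) * w $ i) = (\<Sum>i\<in>UNIV. of_int ((0 :: int ^ 'n) $ i) * w $ i)"
    using 0 by simp
  hence "(\<chi> i. z i) = (0 :: int ^ 'n)"
    using w unfolding int_basis_def bij_betw_def inj_on_def by blast
  hence "z i = 0" by (metis vec_lambda_beta zero_index)
  thus ?thesis using N(1) N(2)[of i] by simp
qed

text \<open>Spanning is a dimension count: an element outside the span would give one independent
  vector more than the degree allows.\<close>

lemma field_basisI:
  fixes e :: "'n::finite \<Rightarrow> 'a::field_char_0"
  assumes K: "number_field CARD('n) K" and e: "\<And>i. e i \<in> K"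
    and indep: "\<And>q i. (\<Sum>i\<in>UNIV. of_rat (q i) * e i) = 0 \<Longrightarrow> q i = 0"
  shows "inj e" "field_basis K (range e)"
proof -
  note sf = K[unfolded number_field_def, THEN conjunct1]
  show inj: "inj e"
  proof (rule injI, rule ccontr)
    fix i j assume "e i = e j" "i \<noteq> j"
    let ?q = "\<lambda>k. if k = i then 1 else if k = j then -1 else (0::rat)"
    have "(\<Sum>k\<in>UNIV. of_rat (?q k) * e k) = (\<Sum>k\<in>UNIV. (if k = i then e i else 0) - (if k = j then e j else 0))"
      by (rule sum.cong) (use \<open>i \<noteq> j\<close> in auto)
    also have "\<dots> = 0" using \<open>e i = e j\<close> by (simp add: sum_subtractf)
    finally have "?q i = 0" by (rule indep)
    thus False by simp
  qed
  have ind: "rat_vs.independent (range e)"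
  proof (rule rat_vs.independent_if_scalars_zero)
    fix f x assume 0: "(\<Sum>x\<in>range e. rat_scale (f x) x) = 0" and "x \<in> range e"
    then obtain i where "x = e i" by blast
    have "(\<Sum>i\<in>UNIV. of_rat (f (e i)) * e i) = 0"
      using 0 inj by (simp add: sum.reindex rat_scale_def)
    thus "f x = 0" using indep[of "\<lambda>i. f (e i)"] \<open>x = e i\<close> by simp
  qed simp
  have sub: "rat_vs.subspace K"
    unfolding rat_vs.subspace_def using is_subfield_closed[OF sf] by (simp add: rat_scale_def)
  have "K \<subseteq> rat_vs.span (range e)"
  proof (rule ccontr)
    assume "\<not> ?thesis"
    then obtain x where x: "x \<in> K" "x \<notin> rat_vs.span (range e)" by blast
    have i2: "rat_vs.independent (insert x (range e))" using rat_vs.independent_insertI[OF x(2) ind] .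
    obtain B where B: "B \<subseteq> K" "rat_vs.independent B" "K \<subseteq> rat_vs.span B" "card B = rat_vs.dim K"
      by (rule rat_vs.basis_exists)
    have cB: "card B = CARD('n)" using B(4) K by (simp add: number_field_def)
    \<comment> \<open>\<open>card\<close> is 0 on infinite sets, so a positive value shows
      finiteness.\<close>
    hence "finite B" by (metis card.infinite zero_less_card_finite less_irrefl)
    from rat_vs.independent_span_bound[OF this i2] have "card (insert x (range e)) \<le> card B"
      using x e B(3) by blast
    moreover have "x \<notin> range e" using x(2) rat_vs.span_base by blast
    moreover have "card (range e) = CARD('n)" using inj by (simp add: card_image)
    ultimately show False using cB by simp
  qed
  moreover have "rat_vs.span (range e) \<subseteq> K" using rat_vs.span_minimal[OF _ sub] e by blast
  ultimately show "field_basis K (range e)" using ind by (auto simp: field_basis_def)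
qed

lemma field_basis_combination:
  fixes e :: "'n::finite \<Rightarrow> 'a::field_char_0"
  assumes "field_basis K (range e)" "inj e" "x \<in> K"
  obtains q where "x = (\<Sum>i\<in>UNIV. of_rat (q i) * e i)"
proof -
  have "x \<in> rat_vs.span (range e)" using assms by (simp add: field_basis_def)
  then obtain u where "x = (\<Sum>v\<in>range e. rat_scale (u v) v)"
    using rat_vs.span_finite[of "range e"] by auto
  hence "x = (\<Sum>i\<in>UNIV. of_rat (u (e i)) * e i)" using assms(2) by (simp add: sum.reindex rat_scale_def)
  thus thesis by (rule that)
qed

section \<open>Discriminants of quadratic fields are minimal\<close>

lemma quadratic_field_basis:
  fixes x :: "'a::field_char_0"
  assumes "number_field 2 K" "x \<in> K" "x \<notin> range of_rat"
  shows "inj (($) (vector [1, x] :: 'a^2))" "field_basis K (range (($) (vector [1, x] :: 'a^2)))"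
proof -
  have sf: "is_subfield K" using assms by (simp add: number_field_def)
  have "\<And>i. (vector [1, x] :: 'a^2) $ i \<in> K"
    using assms is_subfield_closed(2)[OF sf] forall_2[of "\<lambda>i. (vector [1, x] :: 'a^2) $ i \<in> K"] by simp
  moreover have "q i = 0" if "(\<Sum>i\<in>UNIV. of_rat (q i) * (vector [1, x] :: 'a^2) $ i) = 0" for q :: "2 \<Rightarrow> rat" and i
  proof -
    have 0: "of_rat (q 1) + of_rat (q 2) * x = 0" using that by (simp add: sum_2)
    have "q 2 = 0"
    proof (rule ccontr)
      assume "q 2 \<noteq> 0"
      hence "x = of_rat (- q 1 / q 2)" using 0
        by (simp add: of_rat_divide of_rat_minus field_simps add_eq_0_iff)
      thus False using assms(3) by blast
    qed
    moreover from this have "q 1 = 0" using 0 by simp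
    ultimately have "\<forall>i. q i = 0" by (simp add: forall_2)
    thus ?thesis by blast
  qed
  ultimately show "inj (($) (vector [1, x] :: 'a^2))" "field_basis K (range (($) (vector [1, x] :: 'a^2)))"
    using field_basisI[where 'n = 2 and K = K and e = "($) (vector [1, x] :: 'a^2)"] assms(1) by auto
qed

lemma algebraic_int_quadratic:
  fixes x :: "'a::field_char_0"
  assumes "x^2 + of_int b * x + of_int c = 0"
  shows "algebraic_int x"
proof (rule algebraic_int.intros)
  show "lead_coeff [:of_int c, of_int b, 1 :: 'a:] = 1" by simp
  show "\<forall>i. coeff [:of_int c, of_int b, 1 :: 'a:] i \<in> \<int>"
    by (auto simp: coeff_pCons split: nat.splits)
  show "poly [:of_int c, of_int b, 1:] x = 0" using assms by (simp add: algebra_simps power2_eq_square)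
qed

text \<open>If \<open>D = n\<^sup>2 E\<close> with \<open>E \<equiv> 0, 1 (mod 4)\<close>, then \<open>(E + \<surd>E) / 2\<close> is an integer of the field, and
  together with 1 it spans a lattice of discriminant \<open>E\<close>.\<close>

lemma quadratic_field_minimal_disc:
  fixes L :: "'a::field_char_0 set"
  assumes L: "number_field 2 L" and D: "has_discriminant TYPE(2) L D"
  shows "minimal_disc D"
  unfolding minimal_disc_def
proof (intro allI impI)
  fix n E :: int assume nE: "D = n^2 * E" "E mod 4 \<in> {0, 1}"
  have sf: "is_subfield L" using L by (simp add: number_field_def)
  note closed = is_subfield_closed[OF sf]
  obtain w :: "'a^2" where w: "int_basis w (ring_of_ints L)"
    "of_int D = det (\<chi> i j. field_trace L (w $ i * w $ j))"
    using D unfolding has_discriminant_def by blast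
  have wL: "of_int i * w $ 1 + of_int j * w $ 2 \<in> ring_of_ints L" for i j
    using int_basis_mem[OF w(1), of "vector [i, j]"] by (simp add: sum_2)
  have w12: "w $ 1 \<in> L" "w $ 2 \<in> L" using wL[of 1 0] wL[of 0 1] by (auto simp: ring_of_ints_def)
  have wind: "q1 = 0 \<and> q2 = 0" if "of_rat q1 * w $ 1 + of_rat q2 * w $ 2 = 0" for q1 q2
    using int_basis_rat_independent[OF w(1), of "($) (vector [q1, q2])" 1]
      int_basis_rat_independent[OF w(1), of "($) (vector [q1, q2])" 2] that by (simp add: sum_2)
  \<comment> \<open>If \<open>L\<close> had only rational elements, the two vectors of the integral
    basis would be linearly dependent.\<close>
  have "\<exists>x \<in> L. x \<notin> range of_rat"
  proof (rule ccontr)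
    assume "\<not> ?thesis"
    then obtain r1 r2 where r: "w $ 1 = of_rat r1" "w $ 2 = of_rat r2" using w12 by blast
    hence "of_rat r2 * w $ 1 + of_rat (- r1) * w $ 2 = 0" by (simp add: of_rat_minus)
    hence "r1 = 0" using wind[of r2 "- r1"] by simp
    hence "of_rat 1 * w $ 1 + of_rat 0 * w $ 2 = 0" using r by simp
    thus False using wind[of 1 0] by simp
  qed
  then obtain x where x: "x \<in> L" "x \<notin> range of_rat" by blast
  have rep2: "\<exists>p q. z = of_rat p + of_rat q * x" if zx: "z \<in> L" "x \<in> L" "x \<notin> range of_rat" for x z
  proof -
    note fb = quadratic_field_basis[OF L zx(2,3)]
    obtain q where "z = (\<Sum>i\<in>UNIV. of_rat (q i) * (vector [1, x] :: 'a^2) $ i)"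
      by (rule field_basis_combination[OF fb(2,1) zx(1)])
    thus ?thesis by (auto simp: sum_2)
  qed
  obtain u t where x2: "x * x = of_rat u + of_rat t * x" using rep2[OF closed(5)[OF x(1) x(1)] x] by blast
  \<comment> \<open>Completing the square: y = x - t / 2 has the rational square \<delta>, and p + q
    y then has trace 2 p.\<close>
  define \<tau> where "\<tau> = t / 2"
  define y where "y = x - of_rat \<tau>"
  define \<delta> where "\<delta> = u + \<tau> * \<tau>"
  have t: "(of_rat t :: 'a) = 2 * of_rat \<tau>" by (simp add: \<tau>_def of_rat_divide)
  have sq: "(z - r) * (z - r) = (z * z - (2 * r) * z) + r * r" for z r :: 'a
    by (simp add: algebra_simps)
  have y2: "y * y = of_rat \<delta>"
    unfolding y_def sq t[symmetric] x2 by (simp add: \<delta>_def of_rat_add of_rat_mult)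
  have yL: "y \<in> L" unfolding y_def by (intro closed x)
  have ynr: "y \<notin> range of_rat"
  proof
    assume "y \<in> range of_rat"
    then obtain s where "y = of_rat s" by blast
    hence "x = of_rat (s + \<tau>)" unfolding y_def by (simp add: of_rat_add algebra_simps)
    thus False using x by blast
  qed
  have ind: "p = p' \<and> q = q'" if "of_rat p + of_rat q * y = of_rat p' + of_rat q' * y" for p q p' q'
  proof -
    have "q = q'"
    proof (rule ccontr)
      assume "q \<noteq> q'"
      moreover have "of_rat (q - q') * y = of_rat (p' - p)" using that by (simp add: of_rat_diff algebra_simps)
      ultimately have "y = of_rat ((p' - p) / (q - q'))" by (simp add: of_rat_divide field_simps)
      thus False using ynr by blast
    qed
    thus ?thesis using that by simp
  qed
  note fb = quadratic_field_basis[OF L yL ynr]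
  have tr: "field_trace L (of_rat p + of_rat q * y) = 2 * p" for p q
  proof -
    let ?m = "\<lambda>i j. (vector [vector [p, q], vector [q * \<delta>, p]] :: rat^2^2) $ i $ j"
    have "field_trace L (of_rat p + of_rat q * y) = (\<Sum>i\<in>UNIV. ?m i i)"
    proof (rule field_trace_eq[OF fb(2,1), where m = ?m])
      fix i
      have "(of_rat q * y) * y = of_rat q * of_rat \<delta>" using y2 by (simp add: mult.assoc)
      thus "(of_rat p + of_rat q * y) * (vector [1, y] :: 'a^2) $ i = (\<Sum>j\<in>UNIV. of_rat (?m i j) * (vector [1, y] :: 'a^2) $ j)"
        using exhaust_2[of i] by (auto simp: sum_2 algebra_simps of_rat_mult)
    qed
    thus ?thesis by (simp add: sum_2)
  qed
  obtain p1 q1 where w1: "w $ 1 = of_rat p1 + of_rat q1 * y" using rep2[OF w12(1) yL ynr] by blast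
  obtain p2 q2 where w2: "w $ 2 = of_rat p2 + of_rat q2 * y" using rep2[OF w12(2) yL ynr] by blast
  have trm: "field_trace L ((of_rat p + of_rat q * y) * (of_rat p' + of_rat q' * y)) = 2 * (p * p' + q * q' * \<delta>)" for p q p' q'
  proof -
    have "(of_rat p + of_rat q * y) * (of_rat p' + of_rat q' * y)
        = of_rat p * of_rat p' + of_rat q * of_rat q' * (y * y) + (of_rat p * of_rat q' + of_rat q * of_rat p') * y"
      by (simp add: algebra_simps)
    also have "\<dots> = of_rat (p * p' + q * q' * \<delta>) + of_rat (p * q' + q * p') * y"
      unfolding y2 by (simp add: of_rat_add of_rat_mult)
    finally show ?thesis using tr by simp
  qed
  \<comment> \<open>The determinant of the integral basis with respect to 1, y. The trace form of 1,
    y is diagonal with entries 2 and 2 \<delta>, whence D = 4 \<kappa>^2 \<delta>.\<close>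
  define \<kappa> where "\<kappa> = p1 * q2 - p2 * q1"
  have D2: "of_int D = (2 * \<kappa>)^2 * \<delta>"
    unfolding w(2) det_2 vec_lambda_beta w1 w2 trm \<kappa>_def by (simp add: algebra_simps power2_eq_square)
  have \<kappa>0: "\<kappa> \<noteq> 0"
  proof
    assume 0: "\<kappa> = 0"
    have "of_rat q2 * w $ 1 + of_rat (- q1) * w $ 2 = of_rat (p1 * q2 - p2 * q1)"
      unfolding w1 w2 by (simp add: of_rat_mult of_rat_diff of_rat_minus algebra_simps)
    hence "of_rat q2 * w $ 1 + of_rat (- q1) * w $ 2 = 0" using 0 by (simp add: \<kappa>_def)
    hence q: "q2 = 0" "q1 = 0" using wind[of q2 "- q1"] by simp_all
    hence "of_rat p2 * w $ 1 + of_rat (- p1) * w $ 2 = 0"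
      unfolding w1 w2 by (simp add: of_rat_minus)
    hence "p1 = 0" using wind[of p2 "- p1"] by simp
    hence "of_rat 1 * w $ 1 + of_rat 0 * w $ 2 = 0" unfolding w1 using q by simp
    thus False using wind[of 1 0] by simp
  qed
  have "\<delta> \<noteq> 0"
  proof
    assume "\<delta> = 0" hence "y = of_rat 0" using y2 by simp
    thus False using ynr by blast
  qed
  hence n0: "n \<noteq> 0" using D2 \<kappa>0 nE(1) by auto
  \<comment> \<open>Chosen so that \<sigma> y squares to D / n^2 = E. Then \<eta> is a root of X^2 -
    E X + (E^2 - E) / 4, which has integral coefficients by the congruence for E.\<close>
  define \<sigma> where "\<sigma> = 2 * \<kappa> / of_int n"
  define \<eta> where "\<eta> = of_rat (of_int E / 2) + of_rat (\<sigma> / 2) * y"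
  have \<sigma>2: "\<sigma>^2 * \<delta> = of_int E"
  proof -
    have "\<sigma>^2 * \<delta> = of_int D / of_int (n^2)" unfolding D2 \<sigma>_def by (simp add: power_divide)
    thus ?thesis using n0 nE(1) by simp
  qed
  have "4 dvd E^2 - E"
  proof -
    have "4 dvd E \<or> 4 dvd E - 1" using nE(2) by (simp add: mod_eq_0_iff_dvd mod_eq_dvd_iff) presburger
    moreover have "E^2 - E = E * (E - 1)" by (simp add: power2_eq_square algebra_simps)
    ultimately show ?thesis by auto
  qed
  then obtain k where k: "E^2 - E = 4 * k" by blast
  have "\<eta> \<in> ring_of_ints L"
  proof -
    have "algebraic_int \<eta>"
    proof (rule algebraic_int_quadratic[where b = "-E" and c = k])
      have "\<eta>^2 = of_rat (of_int E / 2)^2 + of_rat (\<sigma>/2)^2 * (y * y) + 2 * of_rat (of_int E / 2) * of_rat (\<sigma> / 2) * y"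
        unfolding \<eta>_def by (simp add: power2_eq_square algebra_simps)
      also have "of_rat (\<sigma>/2)^2 * (y * y) = of_rat (\<sigma>^2 * \<delta> / 4)"
        unfolding y2 by (simp add: of_rat_mult of_rat_divide of_rat_power power_divide)
      also have "\<dots> = of_rat (of_int E / 4)" unfolding \<sigma>2 ..
      finally have "\<eta>^2 = of_rat (of_int E / 2)^2 + of_rat (of_int E / 4) + 2 * of_rat (of_int E / 2) * of_rat (\<sigma> / 2) * y" .
      moreover have "of_int E * of_int E = (of_int E + 4 * of_int k :: 'a)"
        using arg_cong[OF k, of "of_int :: int \<Rightarrow> 'a"] by (simp add: power2_eq_square algebra_simps)
      ultimately show "\<eta>^2 + of_int (- E) * \<eta> + of_int k = 0"
        unfolding \<eta>_def by (simp add: of_rat_divide power2_eq_square field_simps)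
    qed
    moreover have "\<eta> \<in> L" unfolding \<eta>_def by (intro closed yL)
    ultimately show ?thesis by (simp add: ring_of_ints_def)
  qed
  moreover have "1 \<in> ring_of_ints L" using closed by (simp add: ring_of_ints_def)
  moreover have "\<exists>i j. z = of_int i * w $ 1 + of_int j * w $ 2" if "z \<in> ring_of_ints L" for z
  proof -
    have "z \<in> range (\<lambda>c :: int^2. \<Sum>i\<in>UNIV. of_int (c $ i) * w $ i)"
      using w(1) that unfolding int_basis_def bij_betw_def by blast
    thus ?thesis by (auto simp: sum_2)
  qed
  ultimately obtain i j i' j' where ij: "1 = of_int i * w $ 1 + of_int j * w $ 2"
    "\<eta> = of_int i' * w $ 1 + of_int j' * w $ 2" by metis
  have "of_rat 1 + of_rat 0 * y = of_rat (of_int i * p1 + of_int j * p2) + of_rat (of_int i * q1 + of_int j * q2) * y"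
    using ij(1) unfolding w1 w2 by (simp add: of_rat_add of_rat_mult algebra_simps)
  from ind[OF this] have 1: "of_int i * p1 + of_int j * p2 = 1" "of_int i * q1 + of_int j * q2 = 0" by auto
  have "of_rat (of_int E / 2) + of_rat (\<sigma> / 2) * y = of_rat (of_int i' * p1 + of_int j' * p2) + of_rat (of_int i' * q1 + of_int j' * q2) * y"
    using ij(2) unfolding w1 w2 \<eta>_def by (simp add: of_rat_add of_rat_mult algebra_simps)
  from ind[OF this] have 2: "of_int i' * q1 + of_int j' * q2 = \<sigma> / 2" by auto
  \<comment> \<open>Comparison of determinants: the integral coordinates of 1, \<eta> in the
    integral basis have determinant (\<sigma> / 2) / \<kappa> = 1 / n, so n is a unit.\<close>
  have "of_int (i * j' - i' * j) * \<kappa> = (of_int i * p1 + of_int j * p2) * (of_int i' * q1 + of_int j' * q2)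
      - (of_int i * q1 + of_int j * q2) * (of_int i' * p1 + of_int j' * p2)"
    unfolding \<kappa>_def by (simp add: algebra_simps)
  also have "\<dots> = \<kappa> / of_int n" unfolding 1 2 \<sigma>_def by simp
  finally have "\<kappa> * (of_int (i * j' - i' * j) * of_int n) = \<kappa> * 1" using n0 by (simp add: field_simps)
  hence "of_int (i * j' - i' * j) * of_int n = (1 :: rat)" using \<kappa>0 by (metis mult_cancel_left)
  hence "(i * j' - i' * j) * n = 1" by (metis of_int_eq_1_iff of_int_mult)
  hence "n dvd 1" by (metis dvd_triv_right)
  thus "n^2 = 1" by (auto simp: power2_eq_1_iff)
qed

section \<open>Ramification of 3\<close>

text \<open>The Delone-Faddeev multiplication table, stated without the root \<theta>, so that
  \<open>translate\<close> and \<open>reverse\<close> can change the form by GL2(Z) while the ring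
  stays the same.\<close>

locale cubic_ring =
  fixes R :: "'a::field_char_0 set" and a b c d :: int and \<alpha> \<beta> :: 'a
  assumes mem: "x \<in> R \<longleftrightarrow> (\<exists>m n p. x = of_int m + of_int n * \<alpha> + of_int p * \<beta>)"
    and zero: "of_int m + of_int n * \<alpha> + of_int p * \<beta> = 0 \<Longrightarrow> m = 0 \<and> n = 0 \<and> p = 0"
    and \<alpha>\<alpha>: "\<alpha> * \<alpha> = of_int b * \<alpha> - of_int a * \<beta> - of_int (a * c)"
    and \<beta>\<beta>: "\<beta> * \<beta> = of_int d * \<alpha> - of_int c * \<beta> - of_int (b * d)"
    and \<alpha>\<beta>: "\<alpha> * \<beta> = - of_int (a * d)"
begin

definition lin :: "int \<Rightarrow> int \<Rightarrow> int \<Rightarrow> 'a" where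
  "lin m n p = of_int m + of_int n * \<alpha> + of_int p * \<beta>"

lemma mem_iff: "x \<in> R \<longleftrightarrow> (\<exists>m n p. x = lin m n p)"
  by (simp add: mem lin_def)

lemma lin_add: "lin m n p + lin m' n' p' = lin (m + m') (n + n') (p + p')"
  by (simp add: lin_def algebra_simps)

lemma lin_minus: "- lin m n p = lin (- m) (- n) (- p)"
  by (simp add: lin_def algebra_simps)

lemma lin_eq_iff: "lin m n p = lin m' n' p' \<longleftrightarrow> m = m' \<and> n = n' \<and> p = p'"
proof
  assume "lin m n p = lin m' n' p'"
  hence "of_int (m - m') + of_int (n - n') * \<alpha> + of_int (p - p') * \<beta> = 0"
    by (simp add: lin_def algebra_simps)
  from zero[OF this] show "m = m' \<and> n = n' \<and> p = p'" by simp
qed simp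

lemma lin_mult: "lin m n p * lin m' n' p' =
   lin (m * m' - a * c * n * n' - a * d * (n * p' + p * n') - b * d * p * p')
     (m * n' + n * m' + b * n * n' + d * p * p') (m * p' + p * m' - a * n * n' - c * p * p')"
proof -
  have "lin m n p * lin m' n' p' = of_int (m * m') + of_int (m * n' + n * m') * \<alpha> + of_int (m * p' + p * m') * \<beta>
     + of_int (n * n') * (\<alpha> * \<alpha>) + of_int (n * p' + p * n') * (\<alpha> * \<beta>) + of_int (p * p') * (\<beta> * \<beta>)"
    unfolding lin_def by (simp add: algebra_simps)
  thus ?thesis unfolding \<alpha>\<alpha> \<alpha>\<beta> \<beta>\<beta> by (simp add: lin_def algebra_simps)
qed

lemma one_zero: "1 = lin 1 0 0" "0 = lin 0 0 0"
  by (simp_all add: lin_def)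

lemma cring_int_ring:
  assumes "ring_of_ints K = R" shows "cring (int_ring K)"
proof (rule cringI)
  have R: "x \<in> carrier (int_ring K) \<longleftrightarrow> (\<exists>m n p. x = lin m n p)" for x
    by (simp add: int_ring_def assms mem_iff)
  show "abelian_group (int_ring K)"
  proof (rule abelian_groupI)
    fix x assume "x \<in> carrier (int_ring K)"
    then obtain m n p where "x = lin m n p" using R by blast
    hence "- x \<in> carrier (int_ring K)" using R[of "- x"] lin_minus by blast
    thus "\<exists>y\<in>carrier (int_ring K). y \<oplus>\<^bsub>int_ring K\<^esub> x = \<zero>\<^bsub>int_ring K\<^esub>"
      by (rule bexI[rotated]) (simp add: int_ring_def)
  next
    fix x y assume "x \<in> carrier (int_ring K)" "y \<in> carrier (int_ring K)"
    thus "x \<oplus>\<^bsub>int_ring K\<^esub> y \<in> carrier (int_ring K)"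
      unfolding R by (auto simp: int_ring_def lin_add lin_eq_iff)
  next
    show "\<zero>\<^bsub>int_ring K\<^esub> \<in> carrier (int_ring K)" unfolding R using one_zero(2) by (auto simp: int_ring_def)
  qed (simp_all add: int_ring_def algebra_simps)
  show "comm_monoid (int_ring K)"
  proof (rule comm_monoidI)
    fix x y assume "x \<in> carrier (int_ring K)" "y \<in> carrier (int_ring K)"
    thus "x \<otimes>\<^bsub>int_ring K\<^esub> y \<in> carrier (int_ring K)"
      unfolding R by (auto simp: int_ring_def lin_mult lin_eq_iff)
  next
    show "\<one>\<^bsub>int_ring K\<^esub> \<in> carrier (int_ring K)" unfolding R using one_zero(1) by (auto simp: int_ring_def)
  qed (simp_all add: int_ring_def algebra_simps)
qed (simp add: int_ring_def algebra_simps)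

text \<open>The double root modulo 3 sits at \<open>(0 : 1)\<close>, and \<open>3 \<alpha> = 3 \<beta> = 0\<close> in \<open>R / P\<^sup>2\<close> for the prime
  \<open>P = (3, \<alpha>, \<beta>)\<close>; as 9 does not divide the discriminant, one of \<open>\<alpha> \<beta>\<close> and \<open>\<beta>\<^sup>2\<close> is \<open>\<plusminus>3\<close> in
  \<open>R / P\<^sup>2\<close>.\<close>

lemma ramifies_3:
  assumes R: "ring_of_ints K = R" and c: "3 dvd c" and d: "3 dvd d"
    and D: "\<not> 9 dvd cubic_disc a b c d"
  shows "ramifies 3 K"
proof -
  interpret I: cring "int_ring K" by (rule cring_int_ring[OF R])
  have car: "carrier (int_ring K) = R" and mu: "x \<otimes>\<^bsub>int_ring K\<^esub> y = x * y" and ad: "x \<oplus>\<^bsub>int_ring K\<^esub> y = x + y"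
    for x y by (simp_all add: int_ring_def R)
  have linR: "lin m n p \<in> R" for m n p using mem_iff by blast
  \<comment> \<open>The kernel of the map sending \<open>lin m n p\<close> to m modulo 3, which is
    multiplicative because 3 divides \<open>c\<close> and \<open>d\<close>.\<close>
  define P where "P = {lin (3 * m) n p | m n p. True}"
  have P: "lin m n p \<in> P \<longleftrightarrow> 3 dvd m" for m n p
    unfolding P_def by (auto simp: lin_eq_iff)
  have PR: "x \<in> P \<Longrightarrow> x \<in> R" for x unfolding P_def using linR by blast
  have id: "ideal P (int_ring K)"
  proof (rule idealI[OF I.ring_axioms])
    show "subgroup P (add_monoid (int_ring K))"
    proof (rule I.add.subgroupI)
      show "P \<subseteq> carrier (int_ring K)" using PR car by blast
      show "P \<noteq> {}" using P[of 0 0 0] by auto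
      fix x assume "x \<in> P"
      then obtain m n p where x: "x = lin (3 * m) n p" unfolding P_def by blast
      have "- x \<in> R" "x \<in> R" using x linR lin_minus by metis+
      hence "\<ominus>\<^bsub>int_ring K\<^esub> x = - x"
        by (intro I.sum_zero_eq_neg[symmetric]) (auto simp: int_ring_def R)
      thus "\<ominus>\<^bsub>int_ring K\<^esub> x \<in> P" by (simp add: x lin_minus P)
    next
      fix x y assume "x \<in> P" "y \<in> P"
      thus "x \<oplus>\<^bsub>int_ring K\<^esub> y \<in> P" unfolding ad by (auto simp: P_def lin_add lin_eq_iff) presburger
    qed
    have cl: "x * y \<in> P" if xy: "x \<in> P" "y \<in> R" for x y
    proof -
      obtain m n p where x: "x = lin (3 * m) n p" using xy(1) unfolding P_def by blast
      obtain m' n' p' where y: "y = lin m' n' p'" using xy(2) mem_iff by blast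
      show ?thesis unfolding x y lin_mult P using c d by (intro dvd_diff) auto
    qed
    fix x y assume "x \<in> P" "y \<in> carrier (int_ring K)"
    thus "y \<otimes>\<^bsub>int_ring K\<^esub> x \<in> P" "x \<otimes>\<^bsub>int_ring K\<^esub> y \<in> P"
      using cl[of x y] by (simp_all add: mu car mult.commute)
  qed
  have prime: "primeideal P (int_ring K)"
  proof (rule primeidealI[OF id I.cring_axioms])
    have "lin 1 0 0 \<notin> P" by (simp add: P)
    thus "carrier (int_ring K) \<noteq> P" using linR car by blast
    fix x y assume *: "x \<in> carrier (int_ring K)" "y \<in> carrier (int_ring K)" "x \<otimes>\<^bsub>int_ring K\<^esub> y \<in> P"
    obtain m n p where x: "x = lin m n p" using * car mem_iff by blast
    obtain m' n' p' where y: "y = lin m' n' p'" using * car mem_iff by blast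
    define k where "k = a * c * n * n' + a * d * (n * p' + p * n') + b * d * p * p'"
    have "3 dvd m * m' - k"
      using *(3) unfolding mu x y lin_mult P k_def by (simp add: algebra_simps)
    moreover have "3 dvd k" unfolding k_def using c d by (intro dvd_add) auto
    ultimately have "3 dvd m * m'" by (metis dvd_add diff_add_cancel)
    moreover have "prime (3::int)" by simp
    ultimately have "3 dvd m \<or> 3 dvd m'" using prime_dvd_mult_iff by blast
    thus "x \<in> P \<or> y \<in> P" by (simp add: x y P)
  qed
  have prod: "x * y \<in> ideal_prod (int_ring K) P P" if "x \<in> P" "y \<in> P" for x y
    using ideal_prod.prod[OF that, of "int_ring K"] by (simp add: mu)
  have sum: "x + y \<in> ideal_prod (int_ring K) P P" if "x \<in> ideal_prod (int_ring K) P P" "y \<in> ideal_prod (int_ring K) P P" for x y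
    using ideal_prod.sum[OF that] by (simp add: ad)
  obtain c' d' where c': "c = 3 * c'" and d': "d = 3 * d'" using c d by blast
  have 9: "3 * lin (3 * t) 0 0 \<in> ideal_prod (int_ring K) P P" for t
    using prod[of "lin 3 0 0" "lin (3 * t) 0 0"] by (simp add: P) (simp add: lin_def)
  have "lin 3 0 0 \<in> ideal_prod (int_ring K) P P"
  proof -
    \<comment> \<open>If 9 divided \<open>d\<close>, then, as 3 divides \<open>c\<close>, every term
      of the discriminant would be divisible by 9.\<close>
    have nd: "\<not> 3 dvd d'"
    proof
      assume "3 dvd d'" then obtain e where "d' = 3 * e" by blast
      hence "cubic_disc a b c d = 9 * (b^2 * c'^2 - 12 * a * c'^3 - 4 * b^3 * e - 243 * a^2 * e^2 + 54 * a * b * c' * e)"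
        unfolding cubic_disc_def c' d' by (simp add: algebra_simps power2_eq_square power3_eq_cube)
      thus False using D by simp
    qed
    show ?thesis
    proof (cases "3 dvd a")
      case False
      hence "coprime (3::int) (a * d')" using nd prime_imp_coprime[of "3::int"] by (simp add: prime_dvd_mult_iff)
      then obtain s t where st: "s * (a * d') + t * 3 = 1"
        by (metis bezout_int coprime_iff_gcd_eq_1 gcd.commute)
      \<comment> \<open>The first product is -s \<alpha> \<beta> = s a d, and adding 9 t gives 3 (s
        a d' + 3 t) = 3.\<close>
      have "lin 0 (- s) 0 * lin 0 0 1 + 3 * lin (3 * t) 0 0 \<in> ideal_prod (int_ring K) P P"
        by (intro sum prod 9) (simp_all add: P)
      also have "3 * lin (3 * t) 0 0 = lin (9 * t) 0 0" by (simp add: lin_def)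
      also have "lin 0 (- s) 0 * lin 0 0 1 + lin (9 * t) 0 0 = lin (3 * (s * (a * d') + t * 3)) 0 0"
        unfolding lin_mult lin_add d' lin_eq_iff by (simp add: algebra_simps)
      finally show ?thesis unfolding st by simp
    next
      case True
      have "\<not> 3 dvd b"
      proof
        assume "3 dvd b"
        with True obtain a' b' where "a = 3 * a'" "b = 3 * b'" by blast
        hence "cubic_disc a b c d = 9 * (9 * cubic_disc a' b' c' d')"
          unfolding cubic_disc_def c' d' by (simp add: algebra_simps power2_eq_square power3_eq_cube)
        thus False using D by simp
      qed
      hence "coprime (3::int) (b * d')" using nd prime_imp_coprime[of "3::int"] by (simp add: prime_dvd_mult_iff)
      then obtain s t where st: "s * (b * d') + t * 3 = 1"
        by (metis bezout_int coprime_iff_gcd_eq_1 gcd.commute)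
      \<comment> \<open>-s \<beta>^2 contributes s b d; the product with \<open>lin 3 0 0\<close>
        cancels its \<alpha> and \<beta> components, which are multiples of 3.\<close>
      have "lin 0 0 (- s) * lin 0 0 1 + (lin 0 (s * d') (- s * c') * lin 3 0 0 + 3 * lin (3 * t) 0 0) \<in> ideal_prod (int_ring K) P P"
        by (intro sum prod 9) (simp_all add: P)
      also have "3 * lin (3 * t) 0 0 = lin (9 * t) 0 0" by (simp add: lin_def)
      also have "lin 0 0 (- s) * lin 0 0 1 + (lin 0 (s * d') (- s * c') * lin 3 0 0 + lin (9 * t) 0 0) = lin (3 * (s * (b * d') + t * 3)) 0 0"
        unfolding lin_mult lin_add c' d' lin_eq_iff by (simp add: algebra_simps)
      finally show ?thesis unfolding st by simp
    qed
  qed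
  hence "(of_nat 3 :: 'a) \<in> ideal_prod (int_ring K) P P" by (simp add: lin_def)
  hence "cgenideal (int_ring K) (of_nat 3) \<subseteq> ideal_prod (int_ring K) P P"
    by (rule I.cgenideal_minimal[OF I.ideal_prod_is_ideal[OF id id]])
  thus ?thesis unfolding ramifies_def using prime by blast
qed

text \<open>The form F(x + k y, y) has the root \<theta> - k, from which the new \<alpha> and
  \<beta> are computed. It moves the point (k : 1) to (0 : 1).\<close>

lemma translate:
  "cubic_ring R a (3 * a * k + b) (3 * a * k^2 + 2 * b * k + c) (a * k^3 + b * k^2 + c * k + d)
     (\<alpha> + of_int (a * k)) (\<beta> + of_int k * \<alpha> - of_int (a * k^2 + b * k))" (is "cubic_ring R a ?b ?c ?d ?\<alpha> ?\<beta>")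
proof
  have \<alpha>: "?\<alpha> = lin (a * k) 1 0" and \<beta>: "?\<beta> = lin (- (a * k^2 + b * k)) k 1" by (simp_all add: lin_def)
  have l: "of_int m + of_int n * ?\<alpha> + of_int p * ?\<beta> = lin (m + n * (a * k) - p * (a * k^2 + b * k)) (n + p * k) p" for m n p
    by (simp add: lin_def algebra_simps)
  show "x \<in> R \<longleftrightarrow> (\<exists>m n p. x = of_int m + of_int n * ?\<alpha> + of_int p * ?\<beta>)" for x
  proof
    assume "x \<in> R"
    then obtain m n p where "x = lin m n p" using mem_iff by blast
    also have "\<dots> = of_int (m - (n - p * k) * (a * k) + p * (a * k^2 + b * k)) + of_int (n - p * k) * ?\<alpha> + of_int p * ?\<beta>"
      unfolding l by simp
    finally show "\<exists>m n p. x = of_int m + of_int n * ?\<alpha> + of_int p * ?\<beta>" by blast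
  qed (unfold l mem_iff, blast)
  show "m = 0 \<and> n = 0 \<and> p = 0" if "of_int m + of_int n * ?\<alpha> + of_int p * ?\<beta> = 0" for m n p
    using that unfolding l one_zero(2) lin_eq_iff by auto
  show "?\<alpha> * ?\<alpha> = of_int ?b * ?\<alpha> - of_int a * ?\<beta> - of_int (a * ?c)"
    using l[of "- (a * ?c)" ?b "- a"] unfolding \<alpha> \<beta> lin_mult
    by (simp add: lin_eq_iff algebra_simps power2_eq_square power3_eq_cube)
  show "?\<beta> * ?\<beta> = of_int ?d * ?\<alpha> - of_int ?c * ?\<beta> - of_int (?b * ?d)"
    using l[of "- (?b * ?d)" ?d "- ?c"] unfolding \<alpha> \<beta> lin_mult
    by (simp add: lin_eq_iff algebra_simps power2_eq_square power3_eq_cube)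
  show "?\<alpha> * ?\<beta> = - of_int (a * ?d)"
    using l[of "- (a * ?d)" 0 0] unfolding \<alpha> \<beta> lin_mult
    by (simp add: lin_eq_iff algebra_simps power2_eq_square power3_eq_cube)
qed

text \<open>F(y, x) has the root 1 / \<theta>, which exchanges \<alpha> and \<beta> up to
  sign.\<close>

lemma reverse: "cubic_ring R d c b a (- \<beta>) (- \<alpha>)"
proof
  have l: "of_int m + of_int n * - \<beta> + of_int p * - \<alpha> = lin m (- p) (- n)" for m n p
    by (simp add: lin_def)
  show "x \<in> R \<longleftrightarrow> (\<exists>m n p. x = of_int m + of_int n * - \<beta> + of_int p * - \<alpha>)" for x
    unfolding l mem_iff by (metis minus_minus)
  show "m = 0 \<and> n = 0 \<and> p = 0" if "of_int m + of_int n * - \<beta> + of_int p * - \<alpha> = 0" for m n p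
    using that unfolding l one_zero(2) lin_eq_iff by auto
qed (use \<alpha>\<alpha> \<beta>\<beta> \<alpha>\<beta> in \<open>auto simp: algebra_simps\<close>)

end

text \<open>A repeated root of a nonzero cubic over F_3 is rational, as a conjugate pair of double
  roots would need degree 4. The candidates are the four points (1 : 0), (0 : 1), (1 : 1), (-1 : 1),
  and the residues of the coefficients are checked exhaustively.\<close>

lemma cubic_double_root_mod_3:
  assumes "3 dvd cubic_disc a b c d"
  shows "3 dvd a \<and> 3 dvd b \<or>
    (\<exists>k. 3 dvd 3 * a * k^2 + 2 * b * k + c \<and> 3 dvd a * k^3 + b * k^2 + c * k + d)"
proof -
  have red: "\<exists>i\<in>{0, 1, 2}. [x = i] (mod 3)" for x :: int
    by (rule bexI[of _ "x mod 3"]) (auto simp: cong_def)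
  obtain i j k l where ijkl: "i \<in> {0, 1, 2}" "j \<in> {0, 1, 2}" "k \<in> {0, 1, 2}" "l \<in> {0, 1, 2}"
    "[a = i] (mod 3)" "[b = j] (mod 3)" "[c = k] (mod 3)" "[d = l] (mod 3)"
    using red[of a] red[of b] red[of c] red[of d] by blast
  have "[cubic_disc a b c d = cubic_disc i j k l] (mod 3)"
    unfolding cubic_disc_def by (intro cong_add cong_diff cong_mult cong_pow cong_refl ijkl)
  hence D: "3 dvd cubic_disc i j k l" using assms by (simp add: cong_dvd_iff)
  have "3 dvd i \<and> 3 dvd j \<or> 3 dvd k \<and> 3 dvd l \<or> 3 dvd 2 * j + k \<and> 3 dvd i + j + k + l
      \<or> 3 dvd k - 2 * j \<and> 3 dvd j - i - k + l"
    using ijkl(1-4) D unfolding cubic_disc_def by (elim insertE emptyE) simp_all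
  moreover have "3 dvd i \<longleftrightarrow> 3 dvd a" "3 dvd j \<longleftrightarrow> 3 dvd b" "3 dvd k \<longleftrightarrow> 3 dvd c" "3 dvd l \<longleftrightarrow> 3 dvd d"
    using ijkl by (simp_all add: cong_dvd_iff)
  moreover have "[2 * b + c = 2 * j + k] (mod 3)" "[a + b + c + d = i + j + k + l] (mod 3)"
    "[c - 2 * b = k - 2 * j] (mod 3)" "[b - a - c + d = j - i - k + l] (mod 3)"
    by (intro cong_add cong_diff cong_mult cong_refl ijkl)+
  hence "3 dvd 2 * j + k \<longleftrightarrow> 3 dvd 2 * b + c" "3 dvd i + j + k + l \<longleftrightarrow> 3 dvd a + b + c + d"
    "3 dvd k - 2 * j \<longleftrightarrow> 3 dvd c - 2 * b" "3 dvd j - i - k + l \<longleftrightarrow> 3 dvd b - a - c + d"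
    by (simp_all add: cong_dvd_iff)
  ultimately consider "3 dvd a \<and> 3 dvd b" | "3 dvd c \<and> 3 dvd d" | "3 dvd 2 * b + c \<and> 3 dvd a + b + c + d"
    | "3 dvd c - 2 * b \<and> 3 dvd b - a - c + d" by blast
  thus ?thesis
  proof cases
    case 1 thus ?thesis by blast
  next
    case 2 thus ?thesis by (intro disjI2 exI[of _ 0]) simp
  next
    case 3
    hence "3 dvd 3 * a + (2 * b + c)" by presburger
    thus ?thesis using 3 by (intro disjI2 exI[of _ 1]) (simp add: algebra_simps)
  next
    case 4
    hence "3 dvd 3 * a + (c - 2 * b)" by presburger
    thus ?thesis using 4 by (intro disjI2 exI[of _ "-1"]) (simp add: algebra_simps)
  qed
qed

text \<open>If 3 divided the discriminant, the form would have a double root modulo 3; moving it to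
  (0 : 1) puts the ring in the situation of \<open>ramifies_3\<close>.\<close>

lemma (in cubic_ring) unramified_3_not_dvd_disc:
  assumes R: "ring_of_ints K = R" and "minimal_disc (cubic_disc a b c d)" and "\<not> ramifies 3 K"
  shows "\<not> 3 dvd cubic_disc a b c d"
proof
  assume 3: "3 dvd cubic_disc a b c d"
  \<comment> \<open>9 is 1 modulo 4, so the quotient by 9 would still be 0 or 1 modulo 4, against
    minimality.\<close>
  have n9: "\<not> 9 dvd cubic_disc a b c d"
  proof
    assume "9 dvd cubic_disc a b c d"
    then obtain E where E: "cubic_disc a b c d = 3^2 * E" by auto
    have "cubic_disc a b c d mod 4 \<in> {0, 1}"
      using cong_cubic_disc_4[of a b c d] square_mod_4 unfolding cong_def by metis
    hence "E mod 4 \<in> {0, 1}" unfolding E by (auto; presburger)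
    from minimal_discD[OF assms(2) E this] show False by simp
  qed
  from cubic_double_root_mod_3[OF 3] show False
  proof
    assume ab: "3 dvd a \<and> 3 dvd b"
    interpret r: cubic_ring R d c b a "- \<beta>" "- \<alpha>" by (rule reverse)
    have "cubic_disc d c b a = cubic_disc a b c d" by (simp add: cubic_disc_def algebra_simps)
    thus False using r.ramifies_3[OF R] ab n9 assms(3) by simp
  next
    assume "\<exists>k. 3 dvd 3 * a * k^2 + 2 * b * k + c \<and> 3 dvd a * k^3 + b * k^2 + c * k + d"
    then obtain k where k: "3 dvd 3 * a * k^2 + 2 * b * k + c" "3 dvd a * k^3 + b * k^2 + c * k + d" by blast
    interpret r: cubic_ring R a "3 * a * k + b" "3 * a * k^2 + 2 * b * k + c" "a * k^3 + b * k^2 + c * k + d"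
     "\<alpha> + of_int (a * k)" "\<beta> + of_int k * \<alpha> - of_int (a * k^2 + b * k)" by (rule translate)
    have "cubic_disc a (3 * a * k + b) (3 * a * k^2 + 2 * b * k + c) (a * k^3 + b * k^2 + c * k + d) = cubic_disc a b c d"
      unfolding cubic_disc_def by (simp add: algebra_simps power2_eq_square power3_eq_cube)
    thus False using r.ramifies_3[OF R k] n9 assms(3) by simp
  qed
qed

section \<open>The trace form\<close>

lemma vec3_eq: "(v :: 'b::zero ^ 3) = vector [v $ 1, v $ 2, v $ 3]"
  by (simp add: vec_eq_iff forall_3)

text \<open>Dividing the root equation by \<theta> gives \<beta> = -(a \<theta>^2 + b \<theta> + c);
  with \<theta> \<beta> = d this yields the whole multiplication table. That \<theta> is nonzero
  follows from the independence of \<alpha>.\<close>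

lemma cubic_ring_associated:
  assumes "associated_form K D a b c d \<theta>"
  shows "cubic_ring (ring_of_ints K) a b c d (- of_int a * \<theta>) (of_int d / \<theta>)"
proof -
  define \<alpha> where "\<alpha> = - of_int a * \<theta>"
  define \<beta> where "\<beta> = of_int d / \<theta>"
  have B: "int_basis (vector [1, \<alpha>, \<beta>] :: 'a^3) (ring_of_ints K)"
    and F: "of_int a * \<theta>^3 + of_int b * \<theta>^2 + of_int c * \<theta> + of_int d = 0"
    using assms unfolding associated_form_def \<alpha>_def \<beta>_def by blast+
  let ?f = "\<lambda>c :: int^3. \<Sum>i\<in>UNIV. of_int (c $ i) * (vector [1, \<alpha>, \<beta>] :: 'a^3) $ i"
  have f: "?f (vector [m, n, p]) = of_int m + of_int n * \<alpha> + of_int p * \<beta>" for m n p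
    by (simp add: sum_3)
  have inj: "inj ?f" and img: "range ?f = ring_of_ints K"
    using B unfolding int_basis_def bij_betw_def by auto
  have zero: "m = 0 \<and> n = 0 \<and> p = 0" if "of_int m + of_int n * \<alpha> + of_int p * \<beta> = 0" for m n p
  proof -
    have "?f (vector [m, n, p]) = ?f (vector [0, 0, 0])" unfolding f using that by simp
    hence "(vector [m, n, p] :: int^3) = vector [0, 0, 0]" using inj by (meson injD)
    thus ?thesis by (simp add: vec_eq_iff forall_3)
  qed
  have "\<theta> \<noteq> 0" using zero[of 0 1 0] by (auto simp: \<alpha>_def)
  hence \<theta>\<beta>: "\<theta> * \<beta> = of_int d" by (simp add: \<beta>_def)
  have "\<theta> * (\<beta> + (of_int a * \<theta>^2 + of_int b * \<theta> + of_int c)) = 0"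
    using F \<theta>\<beta> by (simp add: algebra_simps power2_eq_square power3_eq_cube)
  hence "\<beta> + (of_int a * \<theta>^2 + of_int b * \<theta> + of_int c) = 0" using \<open>\<theta> \<noteq> 0\<close> by simp
  hence \<beta>2: "\<beta> = - (of_int a * \<theta>^2 + of_int b * \<theta> + of_int c)" by (rule eq_neg_iff_add_eq_0[THEN iffD2])
  have "cubic_ring (ring_of_ints K) a b c d \<alpha> \<beta>"
  proof
    fix x
    show "x \<in> ring_of_ints K \<longleftrightarrow> (\<exists>m n p. x = of_int m + of_int n * \<alpha> + of_int p * \<beta>)"
    proof -
      have "x \<in> ring_of_ints K \<longleftrightarrow> (\<exists>k. x = ?f k)" unfolding img[symmetric] image_iff by simp
      also have "\<dots> \<longleftrightarrow> (\<exists>m n p. x = ?f (vector [m, n, p]))"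
        by (rule iffI, elim exE, subst (asm) vec3_eq) blast+
      finally show ?thesis unfolding f .
    qed
  next
    show "\<alpha> * \<alpha> = of_int b * \<alpha> - of_int a * \<beta> - of_int (a * c)"
      unfolding \<beta>2 \<alpha>_def by (simp add: algebra_simps power2_eq_square)
    have "\<beta> * \<beta> = - (of_int a * \<theta>^2 + of_int b * \<theta> + of_int c) * \<beta>"
      using arg_cong[OF \<beta>2, of "\<lambda>t. t * \<beta>"] .
    also have "\<dots> = - of_int a * \<theta> * (\<theta> * \<beta>) - of_int b * (\<theta> * \<beta>) - of_int c * \<beta>"
      by (simp add: algebra_simps power2_eq_square)
    finally show "\<beta> * \<beta> = of_int d * \<alpha> - of_int c * \<beta> - of_int (b * d)"
      unfolding \<theta>\<beta> by (simp add: \<alpha>_def algebra_simps)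
    have "\<alpha> * \<beta> = - of_int a * (\<theta> * \<beta>)" by (simp add: \<alpha>_def)
    thus "\<alpha> * \<beta> = - of_int (a * d)" unfolding \<theta>\<beta> by simp
  qed (use zero in blast)
  thus ?thesis by (simp add: \<alpha>_def \<beta>_def)
qed

locale cubic_field = cubic_ring "ring_of_ints K" a b c d \<alpha> \<beta>
  for K :: "'a::field_char_0 set" and a b c d \<alpha> \<beta> +
  assumes field: "number_field 3 K"
    and basis: "int_basis (vector [1, \<alpha>, \<beta>] :: 'a ^ 3) (ring_of_ints K)"
begin

lemma field_trace_combination:
  "field_trace K (of_rat x + of_rat y * \<alpha> + of_rat z * \<beta>) = 3 * x + of_int b * y - of_int c * z"
proof -
  let ?e = "($) (vector [1, \<alpha>, \<beta>] :: 'a^3)"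
  \<comment> \<open>The rows are the coordinates of the element times 1, \<alpha> and \<beta>, taken
    from the multiplication table.\<close>
  let ?m = "\<lambda>i j. (vector [vector [x, y, z],
     vector [- of_int (a * c) * y - of_int (a * d) * z, x + of_int b * y, - of_int a * y],
     vector [- of_int (a * d) * y - of_int (b * d) * z, of_int d * z, x - of_int c * z]] :: rat^3^3) $ i $ j"
  let ?x = "of_rat x + of_rat y * \<alpha> + of_rat z * \<beta>"
  have "lin m n p \<in> K" for m n p using mem_iff[of "lin m n p"] by (auto simp: ring_of_ints_def)
  from this[of 1 0 0] this[of 0 1 0] this[of 0 0 1] have K: "1 \<in> K" "\<alpha> \<in> K" "\<beta> \<in> K"
    by (simp_all add: lin_def)
  have eK: "?e i \<in> K" for i using K forall_3[of "\<lambda>i. ?e i \<in> K"] by simp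
  have ind: "q i = 0" if "(\<Sum>i\<in>UNIV. of_rat (q i) * ?e i) = 0" for q i
    by (rule int_basis_rat_independent[OF basis that])
  have card: "number_field CARD(3) K" using field by simp
  have fb: "field_basis K (range ?e)" by (rule field_basisI(2)[of K ?e, OF card]) (rule eK, erule ind)
  have inj: "inj ?e" by (rule field_basisI(1)[of K ?e, OF card]) (rule eK, erule ind)
  have x\<alpha>: "?x * \<alpha> = of_rat x * \<alpha> + of_rat y * (\<alpha> * \<alpha>) + of_rat z * (\<alpha> * \<beta>)"
    and x\<beta>: "?x * \<beta> = of_rat x * \<beta> + of_rat y * (\<alpha> * \<beta>) + of_rat z * (\<beta> * \<beta>)"
    by (simp_all add: algebra_simps)
  have "field_trace K ?x = (\<Sum>i\<in>UNIV. ?m i i)"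
  proof (rule field_trace_eq[OF fb inj, where m = ?m])
    fix i :: 3
    consider "i = 1" | "i = 2" | "i = 3" using exhaust_3 by blast
    thus "?x * ?e i = (\<Sum>j\<in>UNIV. of_rat (?m i j) * ?e j)"
    proof cases
      case 1 thus ?thesis by (simp add: sum_3)
    next
      case 2
      have "?x * \<alpha> = of_rat (?m 2 1) + of_rat (?m 2 2) * \<alpha> + of_rat (?m 2 3) * \<beta>"
        unfolding x\<alpha> \<alpha>\<alpha> \<alpha>\<beta>
        by (simp add: of_rat_mult of_rat_add of_rat_diff of_rat_minus algebra_simps)
      thus ?thesis using 2 by (simp add: sum_3)
    next
      case 3
      have "?x * \<beta> = of_rat (?m 3 1) + of_rat (?m 3 2) * \<alpha> + of_rat (?m 3 3) * \<beta>"
        unfolding x\<beta> \<beta>\<beta> \<alpha>\<beta>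
        by (simp add: of_rat_mult of_rat_add of_rat_diff of_rat_minus algebra_simps)
      thus ?thesis using 3 by (simp add: sum_3)
    qed
  qed
  thus ?thesis by (simp add: sum_3)
qed

text \<open>\<open>n \<alpha>\<^sub>0 + p \<beta>\<^sub>0\<close> in the paper's notation.\<close>

definition tf :: "int \<Rightarrow> int \<Rightarrow> 'a" where
  "tf n p = of_rat (- of_int (b * n - c * p) / 3) + of_int n * \<alpha> + of_int p * \<beta>"

lemma trace_free_part_basis:
  "trace_free_part K \<alpha> = tf 1 0" "trace_free_part K \<beta> = tf 0 1"
  using field_trace_combination[of 0 1 0] field_trace_combination[of 0 0 1]
  by (simp_all add: trace_free_part_def tf_def of_rat_divide of_rat_minus)

lemma tf_combination: "of_int x * tf n p + of_int y * tf n' p' = tf (x * n + y * n') (x * p + y * p')"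
  by (simp add: tf_def of_rat_divide of_rat_minus of_rat_add of_rat_diff of_rat_mult field_simps)

lemma tf_eq_lin: "b * n - c * p = 3 * m \<Longrightarrow> tf n p = lin (- m) n p"
  by (simp add: tf_def lin_def of_rat_minus)

lemma tf_inject:
  assumes "tf n p = tf n' p'" shows "n = n' \<and> p = p'"
proof -
  have 3: "3 * tf n p = lin (- (b * n - c * p)) (3 * n) (3 * p)" for n p
  proof -
    have "(of_rat (- of_int (b * n - c * p) / 3) :: 'a) = - of_int (b * n - c * p) / 3"
      by (simp only: of_rat_divide of_rat_minus of_rat_of_int_eq of_rat_numeral_eq)
    thus ?thesis unfolding tf_def lin_def by (simp add: field_simps)
  qed
  show ?thesis using arg_cong[OF assms, of "(*) 3"] unfolding 3 lin_eq_iff by simp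
qed

lemma field_trace_lin: "field_trace K (lin m n p) = of_int (3 * m + b * n - c * p)"
  using field_trace_combination[of "of_int m" "of_int n" "of_int p"] by (simp add: lin_def)

lemma trace_form: "field_trace K (tf n p ^ 2) = 2 / 3 * of_int (hessian a b c d (vector [n, p]))"
proof -
  define r :: rat where "r = - of_int (b * n - c * p) / 3"
  define N P where "N = rat_of_int n" "P = rat_of_int p"
  note NP = N_P_def
  have tf: "tf n p = of_rat r + of_rat N * \<alpha> + of_rat P * \<beta>" by (simp add: tf_def r_def NP)
  have "tf n p ^ 2 = of_rat r * of_rat r + 2 * of_rat r * of_rat N * \<alpha> + 2 * of_rat r * of_rat P * \<beta>
     + of_rat N * of_rat N * (\<alpha> * \<alpha>) + 2 * of_rat N * of_rat P * (\<alpha> * \<beta>) + of_rat P * of_rat P * (\<beta> * \<beta>)"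
    unfolding tf by (simp add: power2_eq_square algebra_simps)
  also have "\<dots> = of_rat (r * r - of_int (a * c) * N * N - 2 * of_int (a * d) * N * P - of_int (b * d) * P * P)
     + of_rat (2 * r * N + of_int b * N * N + of_int d * P * P) * \<alpha>
     + of_rat (2 * r * P - of_int a * N * N - of_int c * P * P) * \<beta>"
    unfolding \<alpha>\<alpha> \<alpha>\<beta> \<beta>\<beta> by (simp add: of_rat_mult of_rat_add of_rat_diff algebra_simps)
  finally have "field_trace K (tf n p ^ 2) =
      3 * (r * r - of_int (a * c) * N * N - 2 * of_int (a * d) * N * P - of_int (b * d) * P * P)
      + of_int b * (2 * r * N + of_int b * N * N + of_int d * P * P)
      - of_int c * (2 * r * P - of_int a * N * N - of_int c * P * P)"
    by (simp only: field_trace_combination)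
  also have "\<dots> = 2 / 3 * of_int (hessian a b c d (vector [n, p]))"
    unfolding r_def NP hessian_def by (simp add: field_simps power2_eq_square)
  finally show ?thesis .
qed

text \<open>Since m + n \<alpha> + p \<beta> has trace 3 m + b n - c p, a trace-zero integer is
  determined by (n, p), and a pair occurs exactly when 3 divides \<open>b * n - c * p\<close>. The
  hypotheses make u, v a basis of this lattice of pairs.\<close>

lemma int_basis_trace_zero:
  assumes in0: "3 dvd b * u1 - c * u2" "3 dvd b * v1 - c * v2"
    and det: "u1 * v2 - u2 * v1 \<noteq> 0"
    and gen: "\<And>n p. 3 dvd b * n - c * p \<Longrightarrow> \<exists>i j. n = i * u1 + j * v1 \<and> p = i * u2 + j * v2"
  shows "int_basis (vector [tf u1 u2, tf v1 v2] :: 'a^2) (trace_zero_ints K)"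
proof -
  let ?f = "\<lambda>c :: int^2. \<Sum>i\<in>UNIV. of_int (c $ i) * (vector [tf u1 u2, tf v1 v2] :: 'a^2) $ i"
  have f: "?f k = tf (k $ 1 * u1 + k $ 2 * v1) (k $ 1 * u2 + k $ 2 * v2)" for k
    by (simp add: sum_2 tf_combination)
  have "inj ?f"
  proof (rule injI)
    fix k l assume "?f k = ?f l"
    from tf_inject[OF this[unfolded f]]
    have e: "(k $ 1 - l $ 1) * u1 = - (k $ 2 - l $ 2) * v1" "(k $ 1 - l $ 1) * u2 = - (k $ 2 - l $ 2) * v2"
      by (auto simp: algebra_simps)
    have "(k $ 1 - l $ 1) * (u1 * v2 - u2 * v1) = ((k $ 1 - l $ 1) * u1) * v2 - ((k $ 1 - l $ 1) * u2) * v1"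
      by (simp add: algebra_simps)
    also have "\<dots> = 0" unfolding e by (simp add: algebra_simps)
    finally have 1: "k $ 1 = l $ 1" using det by simp
    have "(k $ 2 - l $ 2) * (u1 * v2 - u2 * v1) = - (- (k $ 2 - l $ 2) * v2) * u1 + (- (k $ 2 - l $ 2) * v1) * u2"
      by (simp add: algebra_simps)
    also have "\<dots> = 0" unfolding e[symmetric] by (simp add: algebra_simps)
    finally have "k $ 2 = l $ 2" using det by simp
    with 1 show "k = l" by (simp add: vec_eq_iff forall_2)
  qed
  moreover have "range ?f = trace_zero_ints K"
  proof (intro equalityI subsetI)
    fix x assume "x \<in> range ?f"
    then obtain k :: "int^2" where x: "x = tf (k $ 1 * u1 + k $ 2 * v1) (k $ 1 * u2 + k $ 2 * v2)" using f by auto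
    have "3 dvd k $ 1 * (b * u1 - c * u2) + k $ 2 * (b * v1 - c * v2)" using in0 by simp
    then obtain m where m: "k $ 1 * (b * u1 - c * u2) + k $ 2 * (b * v1 - c * v2) = 3 * m" by blast
    have m': "b * (k $ 1 * u1 + k $ 2 * v1) - c * (k $ 1 * u2 + k $ 2 * v2) = 3 * m"
      unfolding m[symmetric] by (simp add: algebra_simps)
    have xl: "x = lin (- m) (k $ 1 * u1 + k $ 2 * v1) (k $ 1 * u2 + k $ 2 * v2)"
      unfolding x by (rule tf_eq_lin[OF m'])
    moreover have "3 * (- m) + b * (k $ 1 * u1 + k $ 2 * v1) - c * (k $ 1 * u2 + k $ 2 * v2) = 0" using m' by simp
    ultimately have "field_trace K x = 0" using field_trace_lin by (metis of_int_0)
    moreover have "x \<in> ring_of_ints K" using xl mem_iff by blast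
    ultimately show "x \<in> trace_zero_ints K" by (simp add: trace_zero_ints_def)
  next
    fix x assume "x \<in> trace_zero_ints K"
    hence x: "x \<in> ring_of_ints K" "field_trace K x = 0" by (auto simp: trace_zero_ints_def)
    then obtain m n p where l: "x = lin m n p" using mem_iff by blast
    have m: "b * n - c * p = 3 * (- m)" using x(2) unfolding l field_trace_lin of_int_eq_0_iff by simp
    then obtain i j where "n = i * u1 + j * v1" "p = i * u2 + j * v2" using gen[of n p] by (metis dvd_triv_left)
    hence "x = ?f (vector [i, j])" unfolding f l using tf_eq_lin[OF m] by simp
    thus "x \<in> range ?f" by blast
  qed
  ultimately show ?thesis by (simp add: int_basis_def bij_betw_def)
qed

end

section \<open>The class of the half trace form in the four cases\<close>

text \<open>\<open>(u\<^sub>1, u\<^sub>2)\<close> and \<open>(v\<^sub>1, v\<^sub>2)\<close> stand for the coordinates of the basis \<open>u, v\<close> of \<open>O\<^sub>K\<^sup>0\<close> with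
  respect to \<open>\<alpha>\<^sub>0, \<beta>\<^sub>0\<close>.\<close>

definition half_trace_class :: "int \<Rightarrow> int \<Rightarrow> int \<Rightarrow> int \<Rightarrow> int \<Rightarrow> int \<Rightarrow> int \<Rightarrow> int \<Rightarrow> bool" where
  "half_trace_class a b c d u1 u2 v1 v2 \<longleftrightarrow>
    (let \<Delta> = - 3 * cubic_disc a b c d;
         T = cube_class \<Delta> (form_cube a b c d) \<otimes>\<^bsub>cube_class_group \<Delta>\<^esub> cube_class \<Delta> (disc_cube (cubic_disc a b c d))
     in T \<in> carrier (cube_class_group \<Delta>) \<and>
       (\<exists>q \<in> forms \<Delta>. (\<forall>x y. 3 * q (vector [x, y]) = hessian a b c d (vector [x * u1 + y * v1, x * u2 + y * v2])) \<and>
          fst (cube_phi \<Delta> T) = form_class \<Delta> q))"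

text \<open>The matrix (k, l; m, n) brings the double root of the Hessian modulo 3 to (1 : 0), where
  composition with the class above 3 is explicit. The primed matrix identifies the outcome
  \<open>h\<close> with the form \<open>q\<close> of the prescribed basis.\<close>

lemma half_trace_classI:
  fixes a b c d a' b' c' d' :: int
  defines "h \<equiv> bqf_of (3 * b'^2 - a' * c') (3 * (b' * c' - 3 * a' * d')) (3 * (c'^2 - 9 * b' * d'))"
  assumes min: "minimal_disc (- 3 * cubic_disc a b c d)" and three: "\<not> 3 dvd cubic_disc a b c d"
    and disc: "cubic_disc a' (3 * b') c' d' = cubic_disc a b c d"
    and sl: "k * n - l * m = 1"
    and hess: "\<And>x y. hessian a' (3 * b') c' d' (vector [x, y]) = hessian a b c d (vector [k * x + l * y, m * x + n * y])"
    and sl': "k' * n' - l' * m' = 1" and q: "q \<in> forms (- 3 * cubic_disc a b c d)"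
    and qh: "\<And>x y. q (vector [x, y]) = h (vector [k' * x + l' * y, m' * x + n' * y])"
    and "\<And>x y. 3 * q (vector [x, y]) = hessian a b c d (vector [x * u1 + y * v1, x * u2 + y * v2])"
  shows "half_trace_class a b c d u1 u2 v1 v2"
proof -
  have H: "hessian a b c d \<in> forms (- 3 * cubic_disc a b c d)" by (rule hessian_in_forms[OF min])
  have H': "hessian a' (3 * b') c' d' \<in> forms (- 3 * cubic_disc a b c d)"
    using hessian_in_forms[of a' "3 * b'" c' d'] min unfolding disc by blast
  have rel: "(hessian a b c d, hessian a' (3 * b') c' d') \<in> form_rel (- 3 * cubic_disc a b c d)"
    by (rule form_relI[OF H H' sl hess])
  note P = cube_class_product[OF min three disc rel, folded h_def]
  have h: "h \<in> forms (- 3 * cubic_disc a b c d)"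
    using twist_class(1)[of a' b' c' d', unfolded disc, OF min three] by (simp add: h_def)
  have "form_class (- 3 * cubic_disc a b c d) h = form_class (- 3 * cubic_disc a b c d) q"
    using form_class_eq_iff[OF h q] form_relI[OF h q sl' qh] by blast
  thus ?thesis unfolding half_trace_class_def Let_def using P q assms(10) by auto
qed

lemma half_trace_class_b:
  assumes min: "minimal_disc (- 3 * cubic_disc a b c d)" and three: "\<not> 3 dvd cubic_disc a b c d" and "3 dvd b"
  shows "half_trace_class a b c d 1 0 0 3"
proof -
  obtain b' where b: "b = 3 * b'" using assms(3) by blast
  let ?h = "bqf_of (3 * b'^2 - a * c) (3 * (b' * c - 3 * a * d)) (3 * (c^2 - 9 * b' * d))"
  show ?thesis
  proof (rule half_trace_classI[OF min three, where a' = a and b' = b' and c' = c and d' = d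
        and k = 1 and l = 0 and m = 0 and n = 1 and k' = 1 and l' = 0 and m' = 0 and n' = 1 and q = ?h])
    show "?h \<in> forms (- 3 * cubic_disc a b c d)"
      using twist_class(1)[of a b' c d] min three unfolding b by simp
  qed (simp_all add: b hessian_def algebra_simps power2_eq_square)
qed

lemma half_trace_class_c:
  assumes min: "minimal_disc (- 3 * cubic_disc a b c d)" and three: "\<not> 3 dvd cubic_disc a b c d" and "3 dvd c"
  shows "half_trace_class a b c d 3 0 0 1"
proof -
  obtain c' where c: "c = 3 * c'" using assms(3) by blast
  \<comment> \<open>The quarter turn F(y, -x) = (-d, c, -b, a) puts c in the place of b; the same
    turn serves again as the primed matrix.\<close>
  have disc: "cubic_disc (- d) (3 * c') (- b) a = cubic_disc a b c d"
    unfolding cubic_disc_def c by (simp add: algebra_simps power2_eq_square power3_eq_cube)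
  let ?q = "bqf_of (3 * (b^2 - 9 * c' * a)) (3 * (b * c' - 3 * a * d)) (3 * c'^2 - b * d)"
  show ?thesis
  proof (rule half_trace_classI[OF min three disc, where
         k = 0 and l = 1 and m = "-1" and n = 0 and k' = 0 and l' = 1 and m' = "-1" and n' = 0 and q = ?q])
    have e: "(3 * (b * c' - 3 * a * d))^2 - 4 * (3 * (b^2 - 9 * c' * a)) * (3 * c'^2 - b * d) = - 3 * cubic_disc a b c d"
      using hessian_disc[of b c a d] unfolding c by (simp add: algebra_simps power2_eq_square)
    show "?q \<in> forms (- 3 * cubic_disc a b c d)"
      by (rule minimal_disc_forms[OF min e]) (use hessian_pos[of a b c d] in \<open>simp add: c algebra_simps\<close>)
  qed (simp_all add: c hessian_def algebra_simps power2_eq_square)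
qed

text \<open>\<open>e\<close> is 1 or -1, and the second condition on it says that b x - c y vanishes
  modulo 3 at (1 : e). The substitution F(x, e x + y) moves this point to (1 : 0).\<close>

lemma half_trace_class_bc:
  assumes min: "minimal_disc (- 3 * cubic_disc a b c d)" and three: "\<not> 3 dvd cubic_disc a b c d"
    and e: "e * e = 1" "3 dvd b + 2 * c * e"
  shows "half_trace_class a b c d 1 e 0 3"
proof -
  have "3 dvd (b + 2 * c * e) + 3 * d" using e by simp
  then obtain b' where b': "b + 2 * c * e + 3 * d = 3 * b'" by (metis dvdE)
  define a' where "a' = a + b * e + c + d * e"
  define c' where "c' = c + 3 * d * e"
  have ee: "e * (e * x) = x" for x using e(1) by (metis mult.assoc mult_1_left)
  have disc: "cubic_disc a' (3 * b') c' d = cubic_disc a b c d"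
    unfolding cubic_disc_def b'[symmetric] a'_def c'_def
    by (simp add: algebra_simps power2_eq_square power3_eq_cube ee e)
  have H: "hessian a' (3 * b') c' d (vector [x, y]) = hessian a b c d (vector [1 * x + 0 * y, e * x + 1 * y])" for x y
    unfolding hessian_def b'[symmetric] a'_def c'_def
    by (simp add: algebra_simps power2_eq_square ee e)
  let ?h = "bqf_of (3 * b'^2 - a' * c') (3 * (b' * c' - 3 * a' * d)) (3 * (c'^2 - 9 * b' * d))"
  have 3: "3 * ?h (vector [x, y]) = hessian a' (3 * b') c' d (vector [x, 3 * y])" for x y
    unfolding hessian_def by (simp add: algebra_simps power2_eq_square)
  show ?thesis
  proof (rule half_trace_classI[OF min three disc _ H, where
         k' = 1 and l' = 0 and m' = 0 and n' = 1 and q = ?h])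
    show "?h \<in> forms (- 3 * cubic_disc a b c d)"
      using twist_class(1)[of a' b' c' d] min three unfolding disc by simp
    show "3 * ?h (vector [x, y]) = hessian a b c d (vector [x * 1 + y * 0, x * e + y * 3])" for x y
      unfolding 3 H by (simp add: mult.commute)
  qed simp_all
qed

section \<open>From forms back to the cubic field\<close>

text \<open>Three times \<open>q\<close> is the Hessian in the coordinates of the basis, and
  \<open>trace_form\<close> carries the factor 2/3. Of the two signs, the alternative without the
  inverse is established.\<close>

lemma (in cubic_field) half_trace_form:
  assumes "dK = cubic_disc a b c d" and cl: "half_trace_class a b c d u1 u2 v1 v2"
    and ib: "int_basis (vector [tf u1 u2, tf v1 v2] :: 'a^2) (trace_zero_ints K)"
  shows "let \<Delta> = - 3 * dK;
             Cl = narrow_class_group \<Delta>;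
             T = cube_class \<Delta> (form_cube a b c d) \<otimes>\<^bsub>cube_class_group \<Delta>\<^esub> cube_class \<Delta> (disc_cube dK);
             P = (fst \<circ> cube_phi \<Delta>) T
         in T \<in> carrier (cube_class_group \<Delta>) \<and>
            int_basis (vector [tf u1 u2, tf v1 v2] :: 'a ^ 2) (trace_zero_ints K) \<and>
            (\<exists>q \<in> forms \<Delta>.
               (\<forall>x y. of_int (q (vector [x, y])) =
                  1 / 2 * field_trace K ((of_int x * tf u1 u2 + of_int y * tf v1 v2)^2)) \<and>
               (P = form_class \<Delta> q \<or> inv\<^bsub>Cl\<^esub> P = form_class \<Delta> q))"
proof -
  have "of_int q = 1 / 2 * field_trace K ((of_int x * tf u1 u2 + of_int y * tf v1 v2)^2)"
    if "3 * q = hessian a b c d (vector [x * u1 + y * v1, x * u2 + y * v2])" for q x y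
    unfolding tf_combination trace_form that[symmetric] by simp
  thus ?thesis
    using cl ib unfolding half_trace_class_def Let_def assms(1) o_def by blast
qed

lemma (in cubic_field) tf_scale: "3 * tf n p = tf (3 * n) (3 * p)"
  using tf_combination[of 3 n p 0 0 0] by simp

lemma (in cubic_field) tf_add: "tf n p + tf n' p' = tf (n + n') (p + p')"
  using tf_combination[of 1 n p 1 n' p'] by simp

lemma (in cubic_field) tf_diff: "tf n p - tf n' p' = tf (n - n') (p - p')"
  using tf_combination[of 1 n p "-1" n' p'] by simp

theorem theorem6p2:
  fixes K :: "'a::field_char_0 set"
    and dK a b c d :: int
    and \<theta> \<alpha> \<beta> \<alpha>0 \<beta>0 u v :: 'a
  assumes "number_field 3 K"
    and "has_discriminant TYPE(3) K dK"
    and "fundamental_discriminant dK"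
    and "\<not> ramifies 3 K"
    and "associated_form K dK a b c d \<theta>"
    and "\<alpha> = - of_int a * \<theta>"
    and "\<beta> = of_int d / \<theta>"
    and "\<alpha>0 = trace_free_part K \<alpha>"
    and "\<beta>0 = trace_free_part K \<beta>"
    and "[b = 0] (mod 3) \<and> u = \<alpha>0 \<and> v = 3 * \<beta>0 \<or>
         [c = 0] (mod 3) \<and> u = 3 * \<alpha>0 \<and> v = \<beta>0 \<or>
         [b = - c] (mod 3) \<and> u = \<alpha>0 - \<beta>0 \<and> v = 3 * \<beta>0 \<or>
         [b = c] (mod 3) \<and> u = \<alpha>0 + \<beta>0 \<and> v = 3 * \<beta>0"
  shows "let \<Delta> = - 3 * dK;
             Cl = narrow_class_group \<Delta>;
             T = cube_class \<Delta> (form_cube a b c d) \<otimes>\<^bsub>cube_class_group \<Delta>\<^esub> cube_class \<Delta> (disc_cube dK);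
             P = (fst \<circ> cube_phi \<Delta>) T
         in T \<in> carrier (cube_class_group \<Delta>) \<and>
            int_basis (vector [u, v] :: 'a ^ 2) (trace_zero_ints K) \<and>
            (\<exists>q \<in> forms \<Delta>.
               (\<forall>x y. of_int (q (vector [x, y])) =
                  1 / 2 * field_trace K ((of_int x * u + of_int y * v)^2)) \<and>
               (P = form_class \<Delta> q \<or> inv\<^bsub>Cl\<^esub> P = form_class \<Delta> q))"
proof -
  have field: "number_field 3 K" and af: "associated_form K dK a b c d \<theta>" using assms by blast+
  have dK: "dK = cubic_disc a b c d" using af by (simp add: associated_form_def)
  interpret cubic_field K a b c d \<alpha> \<beta>
  proof (intro cubic_field.intro cubic_field_axioms.intro field)
    show "cubic_ring (ring_of_ints K) a b c d \<alpha> \<beta>"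
      using cubic_ring_associated[OF af] assms(6,7) by simp
    show "int_basis (vector [1, \<alpha>, \<beta>] :: 'a^3) (ring_of_ints K)"
      using af unfolding associated_form_def assms(6,7) by blast
  qed
  have min: "minimal_disc (cubic_disc a b c d)"
    using assms(3) quadratic_field_minimal_disc unfolding fundamental_discriminant_def dK by blast
  have three: "\<not> 3 dvd cubic_disc a b c d"
    by (rule unramified_3_not_dvd_disc[OF refl min assms(4)])
  note min' = minimal_disc_times_3[OF min three]
  \<comment> \<open>The linear condition 3 dvd \<open>b * n - c * p\<close> is therefore nontrivial,
    and its solutions have index 3, as the listed bases require.\<close>
  have bc: "\<not> (3 dvd b \<and> 3 dvd c)"
  proof
    assume "3 dvd b \<and> 3 dvd c"
    then obtain b' c' where "b = 3 * b'" "c = 3 * c'" by blast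
    hence "cubic_disc a b c d = 3 * (27 * b'^2 * c'^2 - 36 * a * c'^3 - 36 * b'^3 * d - 9 * a^2 * d^2 + 54 * a * b' * c' * d)"
      unfolding cubic_disc_def by (simp add: algebra_simps power2_eq_square power3_eq_cube)
    thus False using three by simp
  qed
  have \<alpha>0: "\<alpha>0 = tf 1 0" and \<beta>0: "\<beta>0 = tf 0 1" using assms(8,9) trace_free_part_basis by auto
  have p3: "prime (3::int)" by simp
  \<comment> \<open>One case for each point (b : c) of the projective line over F_3.\<close>
  consider (b) "3 dvd b" "u = tf 1 0" "v = tf 0 3" | (c) "3 dvd c" "u = tf 3 0" "v = tf 0 1"
    | (m) "3 dvd b + c" "u = tf 1 (-1)" "v = tf 0 3" | (p) "3 dvd b - c" "u = tf 1 1" "v = tf 0 3"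
    using assms(10) unfolding \<alpha>0 \<beta>0 tf_scale tf_add tf_diff cong_iff_dvd_diff by auto
  thus ?thesis
  proof cases
    case b
    have "int_basis (vector [u, v] :: 'a^2) (trace_zero_ints K)" unfolding b
    proof (rule int_basis_trace_zero)
      fix n p assume "3 dvd b * n - c * p"
      hence "3 dvd c * p" using b(1) by (metis dvd_diff_right_iff dvd_mult2)
      hence "3 dvd p" using bc b(1) p3 prime_dvd_mult_iff by blast
      thus "\<exists>i j. n = i * 1 + j * 0 \<and> p = i * 0 + j * 3" by auto
    qed (use b in auto)
    thus ?thesis unfolding b using half_trace_form[OF dK half_trace_class_b[OF min' three b(1)]] by blast
  next
    case c
    have "int_basis (vector [u, v] :: 'a^2) (trace_zero_ints K)" unfolding c
    proof (rule int_basis_trace_zero)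
      fix n p assume "3 dvd b * n - c * p"
      hence "3 dvd b * n" using c(1) by (metis dvd_diff_left_iff dvd_mult2)
      hence "3 dvd n" using bc c(1) p3 prime_dvd_mult_iff by blast
      thus "\<exists>i j. n = i * 3 + j * 0 \<and> p = i * 0 + j * 1" by auto
    qed (use c in auto)
    thus ?thesis unfolding c using half_trace_form[OF dK half_trace_class_c[OF min' three c(1)]] by blast
  next
    case m
    have nb: "\<not> 3 dvd b" using bc m(1) by presburger
    have "int_basis (vector [u, v] :: 'a^2) (trace_zero_ints K)" unfolding m
    proof (rule int_basis_trace_zero)
      fix n p assume *: "3 dvd b * n - c * p"
      \<comment> \<open>The congruence between b and c turns the condition into divisibility of b (n
        + p), where b is invertible modulo 3.\<close>
      have "b * (n + p) = (b * n - c * p) + (b + c) * p" by (simp add: algebra_simps)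
      hence "3 dvd b * (n + p)" using * m(1) by (metis dvd_add dvd_mult2)
      hence "3 dvd n + p" using nb p3 prime_dvd_mult_iff by blast
      then obtain j where "n + p = 3 * j" by blast
      thus "\<exists>i j. n = i * 1 + j * 0 \<and> p = i * - 1 + j * 3"
        by (intro exI[of _ n] exI[of _ j]) auto
    qed (use m in auto)
    moreover have "half_trace_class a b c d 1 (-1) 0 3"
      by (rule half_trace_class_bc[OF min' three]) (use m(1) in \<open>simp, presburger\<close>)
    ultimately show ?thesis unfolding m using half_trace_form[OF dK] by blast
  next
    case p
    have nb: "\<not> 3 dvd b" using bc p(1) by presburger
    have "int_basis (vector [u, v] :: 'a^2) (trace_zero_ints K)" unfolding p
    proof (rule int_basis_trace_zero)
      fix n p' assume *: "3 dvd b * n - c * p'"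
      have "b * (n - p') = (b * n - c * p') - (b - c) * p'" by (simp add: algebra_simps)
      hence "3 dvd b * (n - p')" using * p(1) by (metis dvd_diff dvd_mult2)
      hence "3 dvd n - p'" using nb p3 prime_dvd_mult_iff by blast
      then obtain j where "n - p' = 3 * j" by blast
      thus "\<exists>i j. n = i * 1 + j * 0 \<and> p' = i * 1 + j * 3"
        by (intro exI[of _ n] exI[of _ "- j"]) auto
    qed (use p in auto)
    moreover have "half_trace_class a b c d 1 1 0 3"
      by (rule half_trace_class_bc[OF min' three]) (use p(1) in \<open>simp, presburger\<close>)
    ultimately show ?thesis unfolding p using half_trace_form[OF dK] by blast
  qed
qed

end
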